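(* Let $F$ be an algebraically closed field of characteristic $0$, let $m\geqslant 2$, and let $\zeta\in F$ be a primitive $m$th root of unity. Suppose $L$ is a finite dimensional $H_{m^2}(\zeta)$-simple $H_{m^2}(\zeta)$-module Lie algebra over $F$ and the solvable radical of $L$ is nonzero. Then $L$ is isomorphic as an $H_{m^2}(\zeta)$-module Lie algebra to the Lie algebra $L(B,0)$ for some finite dimensional simple Lie algebra $B$ over $F$.
   Context: The Taft algebra $H_{m^2}(\zeta)$ is the unital associative $F$-algebra generated by $c,v$ with relations $c^m=1$, $v^m=0$, $vc=\zeta cv$; it is a Hopf algebra with $\Delta(c)=c\otimes c$, $\Delta(v)=c\otimes v+v\otimes 1$, $\varepsilon(c)=1$, $\varepsilon(v)=0$, $S(c)=c^{-1}$, $S(v)=-c^{-1}v$. An $H_{m^2}(\zeta)$-module Lie algebra is a Lie algebra $L$ over $F$ that is a left $H_{m^2}(\zeta)$-module with $h[a,b]=[h_{(1)}a,h_{(2)}b]$ for all $h$ and all $a,b\in L$. Isomorphisms of such algebras are Lie algebra isomorphisms that are also $H_{m^2}(\zeta)$-module maps. $L$ is $H_{m^2}(\zeta)$-simple if $[L,L]\neq 0$ and $L$ has no $H_{m^2}(\zeta)$-invariant ideals other than $0$ and $L$. Quantum notation: $n_\zeta:=1+\zeta+\dots+\zeta^{n-1}$, $n!_\zeta:=n_\zeta(n-1)_\zeta\cdots 1_\zeta$, $0!_\zeta:=1$, $\binom{n}{k}_\zeta:=\dfrac{n!_\zeta}{(n-k)!_\zeta\,k!_\zeta}$, $\binom n0_\zeta=\binom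 nn_\zeta:=1$. Definition of $L(B,0)$: let $L^{(0)}:=B$, let $L^{(1)},\ldots,L^{(m-1)}$ be vector spaces with $F$-linear bijections $\varphi\colon L^{(i-1)}\to L^{(i)}$, $1\leqslant i\leqslant m-1$, and put $\varphi(L^{(m-1)}):=0$. Then $L(B,0):=\bigoplus_{i=0}^{m-1}L^{(i)}$ with $v\varphi(a)=a$ for $a\in L^{(i)}$, $0\leqslant i\leqslant m-2$, $vB=0$, $ca^{(i)}=\zeta^ia^{(i)}$ for $a^{(i)}\in L^{(i)}$, and for $a,b\in B$, $0\leqslant k,\ell<m$: $[\varphi^k(a),\varphi^\ell(b)]:=\binom{k+\ell}{k}_\zeta\,\varphi^{k+\ell}[a,b]$ if $k+\ell<m$, and $[\varphi^k(a),\varphi^\ell(b)]:=0$ if $k+\ell\geqslant m$. This is an $H_{m^2}(\zeta)$-module Lie algebra. *)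

theory Defs
  imports
    "HOL-Algebra.Algebraic_Closure_Type"
    "HOL-Algebra.QuotRing"
    "HOL-Library.Poly_Mapping"
    "HOL-Library.Product_Plus"
    "HOL-Library.Function_Algebras"
begin

section \<open>The Taft algebra\<close>

definition primitive_root :: "nat \<Rightarrow> 'f::field \<Rightarrow> bool" where
  "primitive_root m \<zeta> \<longleftrightarrow> m > 0 \<and> \<zeta> ^ m = 1 \<and> (\<forall>k. 0 < k \<and> k < m \<longrightarrow> \<zeta> ^ k \<noteq> 1)"

datatype taft_gen = Gen_c | Gen_v

text \<open>
  Words in the two generators form a monoid under concatenation. It is written additively, because
  \<open>'w \<Rightarrow>\<^sub>0 'f\<close> is the monoid algebra of the additively written monoid \<open>'w\<close>.
\<close>

datatype taft_word = Word (letters: "taft_gen list")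

instantiation taft_word :: monoid_add
begin
definition "0 = Word []"
definition "u + w = Word (letters u @ letters w)"
instance
  by standard (simp_all add: zero_taft_word_def plus_taft_word_def)
end

text \<open>
  \<open>'f free_taft\<close> is the free unital associative algebra \<open>A = F\<langle>c, v\<rangle>\<close>. The monoid algebra of the
  product monoid, \<open>'f free_taft2\<close>, is \<open>A \<otimes> A\<close>: the pair of words \<open>(u, w)\<close> stands for \<open>u \<otimes> w\<close>.
\<close>

type_synonym 'f free_taft = "taft_word \<Rightarrow>\<^sub>0 'f"
type_synonym 'f free_taft2 = "taft_word \<times> taft_word \<Rightarrow>\<^sub>0 'f"

definition word_c :: taft_word where "word_c = Word [Gen_c]"
definition word_v :: taft_word where "word_v = Word [Gen_v]"

definition free_word :: "taft_word \<Rightarrow> 'f::field free_taft" where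
  "free_word w = Poly_Mapping.single w 1"

definition free_const :: "'f::field \<Rightarrow> 'f free_taft" where
  "free_const s = Poly_Mapping.single 0 s"

abbreviation free_ring :: "'f::field free_taft ring" where
  "free_ring \<equiv> ring_of_type_algebra"

definition taft_ideal :: "nat \<Rightarrow> 'f::field \<Rightarrow> 'f free_taft set" where
  "taft_ideal m \<zeta> = (let c = free_word word_c; v = free_word word_v in
     Idl\<^bsub>free_ring\<^esub> {c ^ m - 1, v ^ m, v * c - free_const \<zeta> * c * v})"

definition taft_algebra :: "nat \<Rightarrow> 'f::field \<Rightarrow> 'f free_taft set ring" where
  "taft_algebra m \<zeta> = free_ring Quot taft_ideal m \<zeta>"

definition taft_class :: "nat \<Rightarrow> 'f::field \<Rightarrow> 'f free_taft \<Rightarrow> 'f free_taft set" where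
  "taft_class m \<zeta> p = taft_ideal m \<zeta> +>\<^bsub>free_ring\<^esub> p"

text \<open>
  The comultiplication is given by the algebra homomorphism \<open>A \<rightarrow> A \<otimes> A\<close> with
  \<open>c \<mapsto> c \<otimes> c\<close> and \<open>v \<mapsto> c \<otimes> v + v \<otimes> 1\<close>; the comultiplication of the Taft algebra sends the class
  of \<open>p\<close> to the class of \<open>free_comult p\<close>.
\<close>

primrec gen_comult :: "taft_gen \<Rightarrow> 'f::field free_taft2" where
  "gen_comult Gen_c = Poly_Mapping.single (word_c, word_c) 1"
| "gen_comult Gen_v = Poly_Mapping.single (word_c, word_v) 1 + Poly_Mapping.single (word_v, 0) 1"

definition free_comult :: "'f::field free_taft \<Rightarrow> 'f free_taft2" where
  "free_comult p = (\<Sum>w\<in>Poly_Mapping.keys p.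
     Poly_Mapping.single 0 (Poly_Mapping.lookup p w) * prod_list (map gen_comult (letters w)))"


section \<open>Lie algebras\<close>

text \<open>
  The underlying space is a subspace \<open>lie_carrier\<close> of an ambient vector space that fills a type.
\<close>

record ('f, 'a) lie =
  lie_carrier :: "'a set"
  scl :: "'f \<Rightarrow> 'a \<Rightarrow> 'a"
  brk :: "'a \<Rightarrow> 'a \<Rightarrow> 'a"

locale lie_algebra = vector_space "scl L"
  for L :: "('f::field, 'a::ab_group_add, 'z) lie_scheme" +
  assumes carrier_subspace: "subspace (lie_carrier L)"
    and brk_closed: "\<lbrakk>x \<in> lie_carrier L; y \<in> lie_carrier L\<rbrakk> \<Longrightarrow> brk L x y \<in> lie_carrier L"
    and brk_add_left: "\<lbrakk>x \<in> lie_carrier L; y \<in> lie_carrier L; z \<in> lie_carrier L\<rbrakk>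
          \<Longrightarrow> brk L (x + y) z = brk L x z + brk L y z"
    and brk_add_right: "\<lbrakk>x \<in> lie_carrier L; y \<in> lie_carrier L; z \<in> lie_carrier L\<rbrakk>
          \<Longrightarrow> brk L x (y + z) = brk L x y + brk L x z"
    and brk_scl_left: "\<lbrakk>x \<in> lie_carrier L; y \<in> lie_carrier L\<rbrakk>
          \<Longrightarrow> brk L (scl L s x) y = scl L s (brk L x y)"
    and brk_scl_right: "\<lbrakk>x \<in> lie_carrier L; y \<in> lie_carrier L\<rbrakk>
          \<Longrightarrow> brk L x (scl L s y) = scl L s (brk L x y)"
    and brk_self: "x \<in> lie_carrier L \<Longrightarrow> brk L x x = 0"
    and jacobi: "\<lbrakk>x \<in> lie_carrier L; y \<in> lie_carrier L; z \<in> lie_carrier L\<rbrakk>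
          \<Longrightarrow> brk L x (brk L y z) + brk L y (brk L z x) + brk L z (brk L x y) = 0"
begin

definition fin_dim :: bool where
  "fin_dim \<longleftrightarrow> (\<exists>S. finite S \<and> span S = lie_carrier L)"

definition lie_ideal :: "'a set \<Rightarrow> bool" where
  "lie_ideal I \<longleftrightarrow> subspace I \<and> I \<subseteq> lie_carrier L \<and>
     (\<forall>x\<in>lie_carrier L. \<forall>y\<in>I. brk L x y \<in> I)"

definition commutator :: "'a set \<Rightarrow> 'a set \<Rightarrow> 'a set" where
  "commutator S T = span {brk L x y | x y. x \<in> S \<and> y \<in> T}"

definition simple :: bool where
  "simple \<longleftrightarrow> commutator (lie_carrier L) (lie_carrier L) \<noteq> {0} \<and>
     (\<forall>I. lie_ideal I \<longrightarrow> I = {0} \<or> I = lie_carrier L)"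

primrec derived_series :: "'a set \<Rightarrow> nat \<Rightarrow> 'a set" where
  "derived_series S 0 = S"
| "derived_series S (Suc n) = commutator (derived_series S n) (derived_series S n)"

definition solvable :: "'a set \<Rightarrow> bool" where
  "solvable S \<longleftrightarrow> (\<exists>n. derived_series S n = {0})"

text \<open>
  The sum of all solvable ideals; in finite dimension this is the largest solvable ideal.
\<close>

definition solvable_radical :: "'a set" where
  "solvable_radical = span (\<Union>{I. lie_ideal I \<and> solvable I})"

end


section \<open>Module Lie algebras over the Taft algebra\<close>

record (overloaded) ('f::zero, 'a) taft_lie = "('f, 'a) lie" +
  act :: "'f free_taft set \<Rightarrow> 'a \<Rightarrow> 'a"

text \<open>
  The axiom \<open>act_const\<close> says that the scalars of the Taft algebra act as the scalars of \<open>L\<close>;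
  together with \<open>act_mult\<close> it gives \<open>F\<close>-linearity of the action. The axiom \<open>act_brk\<close> is
  \<open>h[a, b] = [h\<^sub>1 a, h\<^sub>2 b]\<close>, with \<open>\<Delta>(h)\<close> expanded in the pairs of words \<open>u\<close> that occur in it.
\<close>

locale taft_module_lie_algebra = lie_algebra L
  for m :: nat and \<zeta> :: "'f::field" and L :: "('f, 'a::ab_group_add, 'z) taft_lie_scheme" +
  assumes act_closed: "\<lbrakk>h \<in> carrier (taft_algebra m \<zeta>); x \<in> lie_carrier L\<rbrakk>
          \<Longrightarrow> act L h x \<in> lie_carrier L"
    and act_add_right: "\<lbrakk>h \<in> carrier (taft_algebra m \<zeta>); x \<in> lie_carrier L; y \<in> lie_carrier L\<rbrakk>
          \<Longrightarrow> act L h (x + y) = act L h x + act L h y"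
    and act_add_left: "\<lbrakk>h \<in> carrier (taft_algebra m \<zeta>); k \<in> carrier (taft_algebra m \<zeta>);
          x \<in> lie_carrier L\<rbrakk> \<Longrightarrow> act L (h \<oplus>\<^bsub>taft_algebra m \<zeta>\<^esub> k) x = act L h x + act L k x"
    and act_mult: "\<lbrakk>h \<in> carrier (taft_algebra m \<zeta>); k \<in> carrier (taft_algebra m \<zeta>);
          x \<in> lie_carrier L\<rbrakk> \<Longrightarrow> act L (h \<otimes>\<^bsub>taft_algebra m \<zeta>\<^esub> k) x = act L h (act L k x)"
    and act_one: "x \<in> lie_carrier L \<Longrightarrow> act L \<one>\<^bsub>taft_algebra m \<zeta>\<^esub> x = x"
    and act_const: "x \<in> lie_carrier L \<Longrightarrow> act L (taft_class m \<zeta> (free_const s)) x = scl L s x"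
    and act_brk: "\<lbrakk>a \<in> lie_carrier L; b \<in> lie_carrier L\<rbrakk> \<Longrightarrow>
          act L (taft_class m \<zeta> p) (brk L a b) =
          (\<Sum>u\<in>Poly_Mapping.keys (free_comult p).
             scl L (Poly_Mapping.lookup (free_comult p) u)
               (brk L (act L (taft_class m \<zeta> (free_word (fst u))) a)
                      (act L (taft_class m \<zeta> (free_word (snd u))) b)))"
begin

definition invariant :: "'a set \<Rightarrow> bool" where
  "invariant I \<longleftrightarrow> (\<forall>h\<in>carrier (taft_algebra m \<zeta>). \<forall>x\<in>I. act L h x \<in> I)"

definition taft_simple :: bool where
  "taft_simple \<longleftrightarrow> commutator (lie_carrier L) (lie_carrier L) \<noteq> {0} \<and>
     (\<forall>I. lie_ideal I \<and> invariant I \<longrightarrow> I = {0} \<or> I = lie_carrier L)"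

end

definition taft_lie_isomorphic ::
  "nat \<Rightarrow> 'f::field \<Rightarrow> ('f, 'a::ab_group_add, 'y) taft_lie_scheme
     \<Rightarrow> ('f, 'b::ab_group_add, 'z) taft_lie_scheme \<Rightarrow> bool" where
  "taft_lie_isomorphic m \<zeta> L M \<longleftrightarrow> (\<exists>\<theta>.
     bij_betw \<theta> (lie_carrier L) (lie_carrier M) \<and>
     (\<forall>x\<in>lie_carrier L. \<forall>y\<in>lie_carrier L. \<theta> (x + y) = \<theta> x + \<theta> y) \<and>
     (\<forall>s. \<forall>x\<in>lie_carrier L. \<theta> (scl L s x) = scl M s (\<theta> x)) \<and>
     (\<forall>x\<in>lie_carrier L. \<forall>y\<in>lie_carrier L. \<theta> (brk L x y) = brk M (\<theta> x) (\<theta> y)) \<and>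
     (\<forall>h\<in>carrier (taft_algebra m \<zeta>). \<forall>x\<in>lie_carrier L. \<theta> (act L h x) = act M h (\<theta> x)))"


section \<open>The algebra \<open>L(B,0)\<close>\<close>

definition q_int :: "'f::field \<Rightarrow> nat \<Rightarrow> 'f" where
  "q_int \<zeta> n = (\<Sum>i<n. \<zeta> ^ i)"

definition q_fact :: "'f::field \<Rightarrow> nat \<Rightarrow> 'f" where
  "q_fact \<zeta> n = (\<Prod>j=1..n. q_int \<zeta> j)"

definition q_binom :: "'f::field \<Rightarrow> nat \<Rightarrow> nat \<Rightarrow> 'f" where
  "q_binom \<zeta> n k = (if k = 0 \<or> k = n then 1
     else q_fact \<zeta> n / (q_fact \<zeta> (n - k) * q_fact \<zeta> k))"

text \<open>
  The action of the Taft algebra determined by two operators \<open>C\<close> and \<open>V\<close> for the generators. A class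
  \<open>h\<close> acts through any of its representatives; these all act alike when \<open>C\<close> and \<open>V\<close> satisfy the
  defining relations.
\<close>

primrec gen_op :: "('a \<Rightarrow> 'a) \<Rightarrow> ('a \<Rightarrow> 'a) \<Rightarrow> taft_gen \<Rightarrow> 'a \<Rightarrow> 'a" where
  "gen_op C V Gen_c = C"
| "gen_op C V Gen_v = V"

definition free_op :: "('f::field \<Rightarrow> 'a::ab_group_add \<Rightarrow> 'a) \<Rightarrow> ('a \<Rightarrow> 'a) \<Rightarrow> ('a \<Rightarrow> 'a)
    \<Rightarrow> 'f free_taft \<Rightarrow> 'a \<Rightarrow> 'a" where
  "free_op sc C V p x = (\<Sum>w\<in>Poly_Mapping.keys p.
     sc (Poly_Mapping.lookup p w) (foldr (gen_op C V) (letters w) x))"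

definition taft_op :: "('f::field \<Rightarrow> 'a::ab_group_add \<Rightarrow> 'a) \<Rightarrow> ('a \<Rightarrow> 'a) \<Rightarrow> ('a \<Rightarrow> 'a)
    \<Rightarrow> 'f free_taft set \<Rightarrow> 'a \<Rightarrow> 'a" where
  "taft_op sc C V h x = the_elem ((\<lambda>p. free_op sc C V p x) ` h)"

text \<open>
  Each \<open>L\<^sup>(\<^sup>i\<^sup>)\<close> is taken to be a copy of \<open>B\<close>, so that an element of \<open>L(B,0)\<close> is a family \<open>x\<close> with
  components \<open>x i \<in> B\<close> for \<open>i < m\<close> and \<open>x i = 0\<close> for \<open>i \<ge> m\<close>; it equals
  \<open>\<Sum>k<m. \<phi>\<^sup>k (x k)\<close>. The map \<open>\<phi>\<close> is the shift \<open>LB0_phi\<close>, and \<open>B = L\<^sup>(\<^sup>0\<^sup>)\<close> is embedded by \<open>LB0_in\<close>.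
\<close>

definition LB0_in :: "'a::ab_group_add \<Rightarrow> nat \<Rightarrow> 'a" where
  "LB0_in a = (\<lambda>i. if i = 0 then a else 0)"

definition LB0_phi :: "nat \<Rightarrow> (nat \<Rightarrow> 'a::ab_group_add) \<Rightarrow> nat \<Rightarrow> 'a" where
  "LB0_phi m x = (\<lambda>i. if 0 < i \<and> i < m then x (i - 1) else 0)"

definition LB0_scl :: "('f, 'a, 'z) lie_scheme \<Rightarrow> 'f \<Rightarrow> (nat \<Rightarrow> 'a) \<Rightarrow> nat \<Rightarrow> 'a" where
  "LB0_scl B s x = (\<lambda>i. scl B s (x i))"

definition LB0_brk :: "nat \<Rightarrow> 'f::field \<Rightarrow> ('f, 'a::ab_group_add, 'z) lie_scheme
    \<Rightarrow> (nat \<Rightarrow> 'a) \<Rightarrow> (nat \<Rightarrow> 'a) \<Rightarrow> nat \<Rightarrow> 'a" where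
  "LB0_brk m \<zeta> B x y = (\<Sum>k<m. \<Sum>l<m.
     if k + l < m
     then LB0_scl B (q_binom \<zeta> (k + l) k) ((LB0_phi m ^^ (k + l)) (LB0_in (brk B (x k) (y l))))
     else 0)"

definition LB0_c :: "'f::field \<Rightarrow> ('f, 'a, 'z) lie_scheme \<Rightarrow> (nat \<Rightarrow> 'a) \<Rightarrow> nat \<Rightarrow> 'a" where
  "LB0_c \<zeta> B x = (\<lambda>i. scl B (\<zeta> ^ i) (x i))"

definition LB0_v :: "(nat \<Rightarrow> 'a) \<Rightarrow> nat \<Rightarrow> 'a" where
  "LB0_v x = (\<lambda>i. x (Suc i))"

definition LB0 :: "nat \<Rightarrow> 'f::field \<Rightarrow> ('f, 'a::ab_group_add, 'z) lie_scheme
    \<Rightarrow> ('f, nat \<Rightarrow> 'a) taft_lie" where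
  "LB0 m \<zeta> B = \<lparr>
     lie_carrier = {x. (\<forall>i<m. x i \<in> lie_carrier B) \<and> (\<forall>i\<ge>m. x i = 0)},
     scl = LB0_scl B,
     brk = LB0_brk m \<zeta> B,
     act = taft_op (LB0_scl B) (LB0_c \<zeta> B) LB0_v\<rparr>"

end

theory Submission
  imports Defs
begin

text \<open>
  Let \<open>c\<close> and \<open>v\<close> be the operators of the two generators. Take a minimal nonzero abelian \<open>c\<close>-invariant
  ideal \<open>I\<close>. The subspaces \<open>G k = I + v I + \<dots> + v\<^sup>k\<^sup>-\<^sup>1 I\<close> form an ascending chain of \<open>c\<close>-invariant ideals
  that exhausts \<open>L\<close>, say after \<open>N\<close> steps, and \<open>v\<close> induces isomorphisms between consecutive quotients,
  twisted by \<open>c\<close>; hence all these quotients are irreducible and \<open>[G p, G q] \<subseteq> G (p + q - N)\<close>.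
  Comparing \<open>v [a, b]\<close> with \<open>v [b, a]\<close> shows that \<open>c\<close> is trivial on the top quotient, so it acts on the
  quotients by distinct powers of \<open>\<zeta>\<close> and the filtration splits into the eigenspaces \<open>E i\<close> of \<open>c\<close>. The
  operator \<open>v\<close> maps \<open>E (i + 1)\<close> bijectively to \<open>E i\<close> for \<open>i + 1 < N\<close>, and \<open>v\<^sup>m = 0\<close> forces \<open>v\<close> to vanish
  on \<open>B = E 0\<close>. The quantum Leibniz rule then gives the bracket of \<open>L(B, 0)\<close>; since the quantum binomial
  coefficients in it do not vanish, \<open>N = m\<close>.
\<close>


section \<open>Lie algebras\<close>

context lie_algebra
begin

abbreviation K :: "'a set" where "K \<equiv> lie_carrier L"

abbreviation smul (infixr "\<cdot>" 75) where "s \<cdot> x \<equiv> scl L s x"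

abbreviation bracket ("\<langle>_,/ _\<rangle>") where "\<langle>x, y\<rangle> \<equiv> brk L x y"

lemmas carrier_0 [simp] = subspace_0[OF carrier_subspace]
lemmas carrier_add [simp] = subspace_add[OF carrier_subspace]
lemmas carrier_scl [simp] = subspace_scale[OF carrier_subspace]
lemmas carrier_diff [simp] = subspace_diff[OF carrier_subspace]
lemmas carrier_sum [simp] = subspace_sum[OF carrier_subspace]
lemmas [simp] = brk_closed

lemma brk_0_left [simp]: "x \<in> K \<Longrightarrow> \<langle>0, x\<rangle> = 0"
  using brk_add_left[of 0 0 x] by simp

lemma brk_0_right [simp]: "x \<in> K \<Longrightarrow> \<langle>x, 0\<rangle> = 0"
  using brk_add_right[of x 0 0] by simp

lemma brk_anticomm:
  assumes "x \<in> K" "y \<in> K" shows "\<langle>x, y\<rangle> = - \<langle>y, x\<rangle>"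
proof -
  have "0 = \<langle>x + y, x + y\<rangle>" using assms by (simp add: brk_self)
  also have "\<dots> = \<langle>x, y\<rangle> + \<langle>y, x\<rangle>"
    using assms by (simp add: brk_add_left brk_add_right brk_self[of x] brk_self[of y])
  finally show ?thesis by (simp add: eq_neg_iff_add_eq_0)
qed

lemma brk_diff_left: "\<lbrakk>x \<in> K; y \<in> K; z \<in> K\<rbrakk> \<Longrightarrow> \<langle>x - y, z\<rangle> = \<langle>x, z\<rangle> - \<langle>y, z\<rangle>"
  using brk_add_left[of "x - y" y z] by (simp add: algebra_simps)

lemma brk_diff_right: "\<lbrakk>x \<in> K; y \<in> K; z \<in> K\<rbrakk> \<Longrightarrow> \<langle>x, y - z\<rangle> = \<langle>x, y\<rangle> - \<langle>x, z\<rangle>"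
  using brk_add_right[of x "y - z" z] by (simp add: algebra_simps)

lemma brk_sum_left:
  "\<lbrakk>\<And>i. i \<in> A \<Longrightarrow> f i \<in> K; y \<in> K\<rbrakk> \<Longrightarrow> \<langle>\<Sum>i\<in>A. f i, y\<rangle> = (\<Sum>i\<in>A. \<langle>f i, y\<rangle>)"
  by (induction A rule: infinite_finite_induct) (auto simp: brk_add_left)

lemma brk_sum_right:
  "\<lbrakk>\<And>i. i \<in> A \<Longrightarrow> f i \<in> K; x \<in> K\<rbrakk> \<Longrightarrow> \<langle>x, \<Sum>i\<in>A. f i\<rangle> = (\<Sum>i\<in>A. \<langle>x, f i\<rangle>)"
  by (induction A rule: infinite_finite_induct) (auto simp: brk_add_right)

lemma lie_ideal_right: "\<lbrakk>lie_ideal J; x \<in> K; y \<in> J\<rbrakk> \<Longrightarrow> \<langle>x, y\<rangle> \<in> J"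
  and lie_ideal_left: "\<lbrakk>lie_ideal J; x \<in> K; y \<in> J\<rbrakk> \<Longrightarrow> \<langle>y, x\<rangle> \<in> J"
  unfolding lie_ideal_def using brk_anticomm[of y x] by (auto simp: subspace_neg)

lemma commutator_subset:
  "\<lbrakk>subspace W; \<And>x y. x \<in> S \<Longrightarrow> y \<in> T \<Longrightarrow> \<langle>x, y\<rangle> \<in> W\<rbrakk> \<Longrightarrow> commutator S T \<subseteq> W"
  unfolding commutator_def by (rule span_minimal) auto

lemma brk_in_commutator: "\<lbrakk>x \<in> S; y \<in> T\<rbrakk> \<Longrightarrow> \<langle>x, y\<rangle> \<in> commutator S T"
  unfolding commutator_def by (rule span_base) auto

section \<open>Finite bases and subspaces of least dimension\<close>

lemma finite_basis:
  assumes "fin_dim" "subspace U" "U \<subseteq> K"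
  obtains S where "finite S" "span S = U" "card S = dim U" "independent S"
proof -
  obtain T where T: "finite T" "span T = K" using assms(1) unfolding fin_dim_def by blast
  obtain S where S: "S \<subseteq> U" "independent S" "U \<subseteq> span S" "card S = dim U"
    using basis_exists by blast
  \<comment> \<open>The ambient type may have infinite dimension; \<open>S\<close> is finite as an
    independent set in the span of the finite set \<open>T\<close>.\<close>
  have "finite S" using independent_span_bound[OF T(1) S(2)] S(1) assms(3) T(2) by auto
  moreover have "span S = U" using span_minimal[OF S(1) assms(2)] S(3) by blast
  ultimately show ?thesis using S that by blast
qed

lemma dim_strict_mono:
  assumes "fin_dim" "subspace U" "subspace W" "W \<subseteq> K" "U \<subset> W"
  shows "dim U < dim W"
proof -
  obtain S where S: "finite S" "span S = U" "card S = dim U" "independent S"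
    by (rule finite_basis[OF assms(1,2)]) (use assms in auto)
  obtain T where T: "finite T" "span T = W" "card T = dim W"
    by (rule finite_basis[OF assms(1,3,4)])
  obtain w where w: "w \<in> W" "w \<notin> U" using assms by blast
  have wS: "w \<notin> S" using w S(2) span_base by blast
  have "independent (insert w S)" using independent_insertI w S by blast
  moreover have "insert w S \<subseteq> span T" using w S T assms(5) span_base by auto
  ultimately have "card (insert w S) \<le> card T" using independent_span_bound[OF T(1)] by blast
  then show ?thesis using wS S T by simp
qed

text \<open>A member of least dimension is minimal for inclusion, because a proper inclusion between
  subspaces of \<open>K\<close> lowers \<open>dim\<close>.\<close>

lemma minimal_subspace:
  assumes "fin_dim" "Q U0" "\<And>U. Q U \<Longrightarrow> subspace U \<and> U \<subseteq> K"
  obtains U where "Q U" "\<And>W. \<lbrakk>Q W; W \<subseteq> U\<rbrakk> \<Longrightarrow> W = U"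
proof -
  obtain U where U: "Q U" "\<And>W. Q W \<Longrightarrow> dim U \<le> dim W"
    using ex_has_least_nat[of Q U0 dim] assms(2) by blast
  have "W = U" if "Q W" "W \<subseteq> U" for W
    using that U dim_strict_mono[OF assms(1), of W U] assms(3) by fastforce
  then show ?thesis using U that by blast
qed

end


section \<open>Quantum integers at a root of unity\<close>

lemma primitive_root_power_inj:
  assumes "primitive_root m \<zeta>" "i < m" "j < m" "\<zeta> ^ i = \<zeta> ^ j"
  shows "i = j"
proof -
  have nz: "\<zeta> \<noteq> 0" using assms(1) by (auto simp: primitive_root_def power_0_left)
  have *: "i = j" if "i \<le> j" "j < m" "\<zeta> ^ i = \<zeta> ^ j" for i j
  proof -
    have "\<zeta> ^ i * \<zeta> ^ (j - i) = \<zeta> ^ i * 1" using that power_add[of \<zeta> i "j - i"] by simp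
    then have "\<zeta> ^ (j - i) = 1" using nz by simp
    then show ?thesis using assms(1) that unfolding primitive_root_def
      by (metis diff_is_0_eq le_antisym less_imp_diff_less neq0_conv)
  qed
  show ?thesis using *[of i j] *[of j i] assms by (cases "i \<le> j") auto
qed

text \<open>From \<open>(\<zeta> - 1) * q_int \<zeta> n = \<zeta> ^ n - 1\<close>, whose right side
  is nonzero by primitivity.\<close>

lemma q_int_nonzero:
  assumes "primitive_root m \<zeta>" "0 < n" "n < m"
  shows "q_int \<zeta> n \<noteq> 0"
proof
  assume "q_int \<zeta> n = 0"
  then have "\<zeta> ^ n - 1 = 0"
    using power_diff_1_eq[of \<zeta> n] by (simp add: q_int_def)
  then show False using assms by (auto simp: primitive_root_def)
qed

lemma q_fact_Suc: "q_fact \<zeta> (Suc n) = q_int \<zeta> (Suc n) * q_fact \<zeta> n"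
  by (simp add: q_fact_def)

lemma q_fact_nonzero:
  "\<lbrakk>primitive_root m \<zeta>; n < m\<rbrakk> \<Longrightarrow> q_fact \<zeta> n \<noteq> 0"
  by (induction n) (auto simp: q_fact_Suc q_int_nonzero, simp add: q_fact_def)

lemma q_int_add: "q_int \<zeta> (k + l) = q_int \<zeta> k + \<zeta> ^ k * q_int \<zeta> l"
  by (induction l) (auto simp: q_int_def power_add algebra_simps)

text \<open>The boundary convention in \<open>q_binom\<close> agrees with the quotient formula,
  since quantum factorials below \<open>m\<close> do not vanish.\<close>

lemma q_binom_eq:
  "\<lbrakk>primitive_root m \<zeta>; k + l < m\<rbrakk> \<Longrightarrow>
    q_binom \<zeta> (k + l) k = q_fact \<zeta> (k + l) / (q_fact \<zeta> l * q_fact \<zeta> k)"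
  using q_fact_nonzero[of m \<zeta> "k + l"] by (auto simp: q_binom_def q_fact_def)

text \<open>The quantum Pascal rule, obtained by splitting \<open>q_int\<close> of the total as in
  \<open>q_int_add\<close>. It mirrors the rule for \<open>v\<close> of a bracket: the weight
  \<open>\<zeta> ^ Suc k\<close> is the eigenvalue of \<open>c\<close> on the first factor.\<close>

lemma q_binom_pascal:
  assumes "primitive_root m \<zeta>" "Suc k + Suc l < m"
  shows "q_binom \<zeta> (Suc k + Suc l) (Suc k)
    = \<zeta> ^ Suc k * q_binom \<zeta> (Suc k + l) (Suc k) + q_binom \<zeta> (k + Suc l) k"
proof -
  have nz: "q_fact \<zeta> k \<noteq> 0" "q_fact \<zeta> l \<noteq> 0" "q_int \<zeta> (Suc k) \<noteq> 0" "q_int \<zeta> (Suc l) \<noteq> 0"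
    using assms q_fact_nonzero[of m \<zeta>] q_int_nonzero[of m \<zeta>] by auto
  have i: "q_int \<zeta> (Suc (Suc (k + l))) = q_int \<zeta> (Suc k) + \<zeta> ^ Suc k * q_int \<zeta> (Suc l)"
    using q_int_add[of \<zeta> "Suc k" "Suc l"] by simp
  have *: "q_binom \<zeta> (Suc k + Suc l) (Suc k) = q_fact \<zeta> (Suc k + Suc l) / (q_fact \<zeta> (Suc l) * q_fact \<zeta> (Suc k))"
    "q_binom \<zeta> (Suc k + l) (Suc k) = q_fact \<zeta> (Suc k + l) / (q_fact \<zeta> l * q_fact \<zeta> (Suc k))"
    "q_binom \<zeta> (k + Suc l) k = q_fact \<zeta> (k + Suc l) / (q_fact \<zeta> (Suc l) * q_fact \<zeta> k)"
    using assms by (intro q_binom_eq[OF assms(1)]; simp)+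
  show ?thesis unfolding * using nz by (simp add: q_fact_Suc i field_simps)
qed


section \<open>The operators of the two generators\<close>

text \<open>The properties of the two generators on which the structure argument rests;
  \<open>v_brk\<close> encodes the coproduct of the second generator. Isolating them keeps the
  quotient ring out of that argument.\<close>

locale taft_operators = lie_algebra L
  for L :: "('f::field_char_0, 'a::ab_group_add, 'z) lie_scheme" +
  fixes m :: nat and \<zeta> :: 'f and c v :: "'a \<Rightarrow> 'a"
  assumes m_ge_2: "m \<ge> 2" and primitive: "primitive_root m \<zeta>"
    and c_closed [simp]: "x \<in> K \<Longrightarrow> c x \<in> K"
    and v_closed [simp]: "x \<in> K \<Longrightarrow> v x \<in> K"
    and c_add: "\<lbrakk>x \<in> K; y \<in> K\<rbrakk> \<Longrightarrow> c (x + y) = c x + c y"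
    and v_add: "\<lbrakk>x \<in> K; y \<in> K\<rbrakk> \<Longrightarrow> v (x + y) = v x + v y"
    and c_scl: "x \<in> K \<Longrightarrow> c (s \<cdot> x) = s \<cdot> c x"
    and v_scl: "x \<in> K \<Longrightarrow> v (s \<cdot> x) = s \<cdot> v x"
    and c_pow_m: "x \<in> K \<Longrightarrow> (c ^^ m) x = x"
    and v_pow_m: "x \<in> K \<Longrightarrow> (v ^^ m) x = 0"
    and v_c: "x \<in> K \<Longrightarrow> v (c x) = \<zeta> \<cdot> c (v x)"
    and c_brk: "\<lbrakk>x \<in> K; y \<in> K\<rbrakk> \<Longrightarrow> c \<langle>x, y\<rangle> = \<langle>c x, c y\<rangle>"
    and v_brk: "\<lbrakk>x \<in> K; y \<in> K\<rbrakk> \<Longrightarrow> v \<langle>x, y\<rangle> = \<langle>c x, v y\<rangle> + \<langle>v x, y\<rangle>"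
begin

lemma \<zeta>_nz [simp]: "\<zeta> \<noteq> 0"
  using primitive by (auto simp: primitive_root_def power_0_left)

lemma \<zeta>_pow_m [simp]: "\<zeta> ^ m = 1"
  using primitive by (auto simp: primitive_root_def)

lemma c_0 [simp]: "c 0 = 0" using c_add[of 0 0] by simp

lemma v_0 [simp]: "v 0 = 0" using v_add[of 0 0] by simp

lemma c_diff: "\<lbrakk>x \<in> K; y \<in> K\<rbrakk> \<Longrightarrow> c (x - y) = c x - c y"
  using c_add[of "x - y" y] by (simp add: algebra_simps)

lemma v_diff: "\<lbrakk>x \<in> K; y \<in> K\<rbrakk> \<Longrightarrow> v (x - y) = v x - v y"
  using v_add[of "x - y" y] by (simp add: algebra_simps)

lemma c_sum: "(\<And>i. i \<in> A \<Longrightarrow> f i \<in> K) \<Longrightarrow> c (\<Sum>i\<in>A. f i) = (\<Sum>i\<in>A. c (f i))"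
  by (induction A rule: infinite_finite_induct) (auto simp: c_add)

lemma v_sum: "(\<And>i. i \<in> A \<Longrightarrow> f i \<in> K) \<Longrightarrow> v (\<Sum>i\<in>A. f i) = (\<Sum>i\<in>A. v (f i))"
  by (induction A rule: infinite_finite_induct) (auto simp: v_add)

lemma c_pow_closed [simp]: "x \<in> K \<Longrightarrow> (c ^^ n) x \<in> K" by (induction n) auto

lemma v_pow_closed [simp]: "x \<in> K \<Longrightarrow> (v ^^ n) x \<in> K" by (induction n) auto

lemma c_pow_add: "\<lbrakk>x \<in> K; y \<in> K\<rbrakk> \<Longrightarrow> (c ^^ n) (x + y) = (c ^^ n) x + (c ^^ n) y"
  by (induction n) (auto simp: c_add)

lemma v_pow_add: "\<lbrakk>x \<in> K; y \<in> K\<rbrakk> \<Longrightarrow> (v ^^ n) (x + y) = (v ^^ n) x + (v ^^ n) y"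
  by (induction n) (auto simp: v_add)

lemma c_pow_scl: "x \<in> K \<Longrightarrow> (c ^^ n) (s \<cdot> x) = s \<cdot> (c ^^ n) x"
  by (induction n) (auto simp: c_scl)

lemma v_pow_scl: "x \<in> K \<Longrightarrow> (v ^^ n) (s \<cdot> x) = s \<cdot> (v ^^ n) x"
  by (induction n) (auto simp: v_scl)

lemma c_pow_0 [simp]: "(c ^^ n) 0 = 0"
  by (induction n) auto

lemma v_pow_0 [simp]: "(v ^^ n) 0 = 0"
  by (induction n) auto

lemma v_pow_diff: "\<lbrakk>x \<in> K; y \<in> K\<rbrakk> \<Longrightarrow> (v ^^ n) (x - y) = (v ^^ n) x - (v ^^ n) y"
  by (induction n) (auto simp: v_diff)

lemma c_pow_brk: "\<lbrakk>x \<in> K; y \<in> K\<rbrakk> \<Longrightarrow> (c ^^ n) \<langle>x, y\<rangle> = \<langle>(c ^^ n) x, (c ^^ n) y\<rangle>"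
  by (induction n) (auto simp: c_brk)

text \<open>Allows the first argument of a bracket to be written as \<open>c z\<close>, the form in
  which it occurs in \<open>v_brk\<close>.\<close>

lemma c_surj:
  assumes "x \<in> K" obtains y where "y \<in> K" "x = c y"
proof -
  have "x = c ((c ^^ (m - 1)) x)"
    using c_pow_m[OF assms] m_ge_2 by (cases m) auto
  then show ?thesis using that[of "(c ^^ (m - 1)) x"] assms by simp
qed

section \<open>Ideals invariant under \<open>c\<close>\<close>

definition cideal :: "'a set \<Rightarrow> bool" where
  "cideal J \<longleftrightarrow> lie_ideal J \<and> c ` J \<subseteq> J"

lemma cideal_subspace: "cideal J \<Longrightarrow> subspace J"
  and cideal_carrier: "\<lbrakk>cideal J; x \<in> J\<rbrakk> \<Longrightarrow> x \<in> K"
  and cideal_c: "\<lbrakk>cideal J; x \<in> J\<rbrakk> \<Longrightarrow> c x \<in> J"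
  unfolding cideal_def lie_ideal_def by auto

lemma cideal_right: "\<lbrakk>cideal J; x \<in> K; y \<in> J\<rbrakk> \<Longrightarrow> \<langle>x, y\<rangle> \<in> J"
  and cideal_left: "\<lbrakk>cideal J; x \<in> K; y \<in> J\<rbrakk> \<Longrightarrow> \<langle>y, x\<rangle> \<in> J"
  unfolding cideal_def using lie_ideal_right lie_ideal_left by auto

lemma cidealI:
  assumes "0 \<in> J" "J \<subseteq> K" "\<And>x y. \<lbrakk>x \<in> J; y \<in> J\<rbrakk> \<Longrightarrow> x + y \<in> J" "\<And>s x. x \<in> J \<Longrightarrow> s \<cdot> x \<in> J"
    "\<And>x. x \<in> J \<Longrightarrow> c x \<in> J" "\<And>x y. \<lbrakk>x \<in> K; y \<in> J\<rbrakk> \<Longrightarrow> \<langle>x, y\<rangle> \<in> J"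
  shows "cideal J"
  unfolding cideal_def lie_ideal_def subspace_def using assms by auto

end


section \<open>The filtration generated by a minimal abelian ideal\<close>

locale taft_simple_operators = taft_operators L m \<zeta> c v
  for L :: "('f::field_char_0, 'a::ab_group_add, 'z) lie_scheme"
    and m :: nat and \<zeta> :: 'f and c v :: "'a \<Rightarrow> 'a" +
  fixes I :: "'a set"
  assumes nonabelian: "commutator K K \<noteq> {0}"
    and operator_simple: "\<lbrakk>cideal J; v ` J \<subseteq> J\<rbrakk> \<Longrightarrow> J = {0} \<or> J = K"
    and I_cideal: "cideal I" and I_nonzero: "I \<noteq> {0}"
    and I_minimal: "\<lbrakk>cideal J; J \<subseteq> I\<rbrakk> \<Longrightarrow> J = {0} \<or> J = I"
    and I_abelian: "\<lbrakk>x \<in> I; y \<in> I\<rbrakk> \<Longrightarrow> \<langle>x, y\<rangle> = 0"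
begin

lemma c_v: "x \<in> K \<Longrightarrow> c (v x) = inverse \<zeta> \<cdot> v (c x)"
  by (simp add: v_c)

text \<open>The commutator is a nonzero ideal stable under both operators, so simplicity makes it
  everything.\<close>

lemma commutator_carrier: "commutator K K = K"
proof -
  have sub: "commutator K K \<subseteq> K" by (rule commutator_subset[OF carrier_subspace]) simp
  have sp: "subspace (commutator K K)" unfolding commutator_def by (rule subspace_span)
  have br: "\<langle>x, y\<rangle> \<in> commutator K K" if "x \<in> K" "y \<in> K" for x y
    using that by (rule brk_in_commutator)
  \<comment> \<open>Span induction, applied below to both \<open>c\<close> and \<open>v\<close>.
    Membership in \<open>K\<close> is carried along because the operators are linear only
    there.\<close>
  have lin: "f x \<in> commutator K K"
    if f: "\<And>x y. \<lbrakk>x \<in> K; y \<in> K\<rbrakk> \<Longrightarrow> f (x + y) = f x + f y" "\<And>s x. x \<in> K \<Longrightarrow> f (s \<cdot> x) = s \<cdot> f x"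
      "\<And>x y. \<lbrakk>x \<in> K; y \<in> K\<rbrakk> \<Longrightarrow> f \<langle>x, y\<rangle> \<in> commutator K K" and x: "x \<in> commutator K K" for f x
  proof -
    have "x \<in> K \<and> f x \<in> commutator K K"
      using x unfolding commutator_def
    proof (induction rule: span_induct_alt)
      case base
      have "f 0 = 0" using f(1)[of 0 0] by simp
      then show ?case using span_zero by simp
    next
      case (step s x y)
      then obtain a b where ab: "a \<in> K" "b \<in> K" "x = \<langle>a, b\<rangle>" by blast
      then show ?case using step f(3)[OF ab(1,2)]
        by (auto simp: f commutator_def intro!: span_add span_scale)
    qed
    then show ?thesis by blast
  qed
  have c: "c x \<in> commutator K K" if "x \<in> commutator K K" for x
    by (rule lin[OF c_add c_scl _ that]) (simp_all add: c_brk br)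
  have v: "v x \<in> commutator K K" if "x \<in> commutator K K" for x
    by (rule lin[OF v_add v_scl _ that]) (simp_all add: v_brk br subspace_add[OF sp])
  have "cideal (commutator K K)"
    using sub sp br c by (intro cidealI) (auto simp: subspace_0 subspace_add subspace_scale)
  moreover have "v ` commutator K K \<subseteq> commutator K K"
    using v by blast
  ultimately show ?thesis using operator_simple nonabelian by blast
qed

lemma perfect: "\<lbrakk>subspace W; \<And>x y. \<lbrakk>x \<in> K; y \<in> K\<rbrakk> \<Longrightarrow> \<langle>x, y\<rangle> \<in> W\<rbrakk> \<Longrightarrow> K \<subseteq> W"
  using commutator_subset[of W K K] by (simp add: commutator_carrier)

section \<open>The ascending chain of ideals \<open>G k\<close>\<close>

primrec G :: "nat \<Rightarrow> 'a set" where
  "G 0 = {0}"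
| "G (Suc k) = {a + v b | a b. a \<in> I \<and> b \<in> G k}"

declare G.simps(2) [simp del]

lemma G_carrier: "x \<in> G k \<Longrightarrow> x \<in> K"
  by (induction k arbitrary: x) (auto simp: G.simps cideal_carrier[OF I_cideal])

lemma G_mono_Suc: "G k \<subseteq> G (Suc k)"
proof (induction k)
  case 0
  have "0 = 0 + v 0" by simp
  then show ?case using subspace_0[OF cideal_subspace[OF I_cideal]] by (fastforce simp: G.simps(2))
next
  case (Suc k)
  then show ?case unfolding G.simps(2)[of k] G.simps(2)[of "Suc k"] by blast
qed

lemma G_mono: "k \<le> l \<Longrightarrow> G k \<subseteq> G l"
  using lift_Suc_mono_le[of G] G_mono_Suc by blast

lemma v_G: "x \<in> G k \<Longrightarrow> v x \<in> G (Suc k)"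
proof -
  assume "x \<in> G k"
  moreover have "v x = 0 + v x" by simp
  ultimately show ?thesis using subspace_0[OF cideal_subspace[OF I_cideal]] unfolding G.simps(2) by blast
qed

lemma G_1: "G (Suc 0) = I"
  by (auto simp: G.simps(2))

lemma I_G: "I \<subseteq> G (Suc k)"
  using G_1 G_mono[of "Suc 0" "Suc k"] by simp

lemma G_cideal: "cideal (G k)"
proof (induction k)
  case 0
  show ?case by (rule cidealI) auto
next
  case (Suc k)
  note sG = cideal_subspace[OF Suc] and sI = cideal_subspace[OF I_cideal]
  have IK: "x \<in> K" if "x \<in> I" for x using that cideal_carrier[OF I_cideal] by blast
  have in_G: "a + v b \<in> G (Suc k)" if "a \<in> I" "b \<in> G k" for a b
    using that unfolding G.simps(2) by blast
  have add: "x + y \<in> G (Suc k)" if xy: "x \<in> G (Suc k)" "y \<in> G (Suc k)" for x y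
  proof -
    obtain a b a' b' where *: "x = a + v b" "y = a' + v b'" "a \<in> I" "a' \<in> I" "b \<in> G k" "b' \<in> G k"
      using xy unfolding G.simps(2) by blast
    then have "x + y = (a + a') + v (b + b')" by (simp add: v_add G_carrier)
    then show ?thesis using in_G * subspace_add[OF sG] subspace_add[OF sI] by metis
  qed
  show ?case
  proof (rule cidealI)
    show "0 \<in> G (Suc k)" using G_mono_Suc subspace_0[OF sG] by blast
    show "G (Suc k) \<subseteq> K" using G_carrier by blast
  next
    fix s x assume "x \<in> G (Suc k)"
    then obtain a b where *: "x = a + v b" "a \<in> I" "b \<in> G k" unfolding G.simps(2) by blast
    then have "s \<cdot> x = s \<cdot> a + v (s \<cdot> b)"
      by (simp add: scale_right_distrib v_scl G_carrier)
    then show "s \<cdot> x \<in> G (Suc k)"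
      using in_G * subspace_scale[OF sG] subspace_scale[OF sI] by metis
    have "c x = c a + v (inverse \<zeta> \<cdot> c b)"
      using * by (simp add: c_add c_v v_scl G_carrier IK)
    then show "c x \<in> G (Suc k)"
      using in_G * subspace_scale[OF sG] cideal_c[OF Suc] cideal_c[OF I_cideal] by metis
  next
    fix x y assume x: "x \<in> K" and "y \<in> G (Suc k)"
    then obtain a b where *: "y = a + v b" "a \<in> I" "b \<in> G k" unfolding G.simps(2) by blast
    \<comment> \<open>With \<open>x = c z\<close>, the rule for \<open>v\<close> of a bracket
      rewrites the bracket of \<open>x\<close> with \<open>v b\<close> as
      \<open>v \<langle>z, b\<rangle> - \<langle>v z, b\<rangle>\<close>, and both terms are under
      control.\<close>
    obtain z where z: "z \<in> K" "x = c z" using c_surj x by blast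
    have [simp]: "a \<in> K" "b \<in> K" using * IK G_carrier by auto
    have "\<langle>x, y\<rangle> = (\<langle>x, a\<rangle> + v \<langle>z, b\<rangle>) + (-1) \<cdot> \<langle>v z, b\<rangle>"
      using * x z by (simp add: brk_add_right v_brk scale_minus_left)
    moreover have "\<langle>x, a\<rangle> + v \<langle>z, b\<rangle> \<in> G (Suc k)"
      using in_G x z * cideal_right[OF I_cideal] cideal_right[OF Suc] by blast
    moreover have "(-1) \<cdot> \<langle>v z, b\<rangle> \<in> G (Suc k)"
      using z * cideal_right[OF Suc] subspace_scale[OF sG] G_mono_Suc v_closed by blast
    ultimately show "\<langle>x, y\<rangle> \<in> G (Suc k)" using add by metis
  qed (rule add)
qed

lemmas G_subspace = cideal_subspace[OF G_cideal]
lemmas G_0 [simp] = subspace_0[OF G_subspace]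
lemmas G_add = subspace_add[OF G_subspace]
lemmas G_diff = subspace_diff[OF G_subspace]
lemmas G_scl = subspace_scale[OF G_subspace]
lemmas G_sum = subspace_sum[OF G_subspace]
lemmas G_c = cideal_c[OF G_cideal]
lemmas G_right = cideal_right[OF G_cideal]
lemmas G_left = cideal_left[OF G_cideal]

lemma G_Suc_cases:
  assumes "x \<in> G (Suc k)" obtains a b where "x = a + v b" "a \<in> I" "a \<in> G (Suc 0)" "b \<in> G k" "b \<in> K" "a \<in> K"
  using assms G_carrier cideal_carrier[OF I_cideal] unfolding G.simps(2) G_1[unfolded G.simps(2)] by auto

text \<open>The recursion splits off the first summand \<open>I\<close>; here the last summand, the
  image of \<open>I\<close> under \<open>v ^^ k\<close>, is split off, so that
  \<open>v ^^ m = 0\<close> can be applied.\<close>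

lemma G_last: "x \<in> G (Suc k) \<Longrightarrow> \<exists>a\<in>G k. \<exists>b\<in>I. x = a + (v ^^ k) b"
proof (induction k arbitrary: x)
  case 0
  then show ?case by (simp add: G_1)
next
  case (Suc k)
  obtain a b where ab: "x = a + v b" "a \<in> I" "b \<in> G (Suc k)" "b \<in> K"
    by (rule G_Suc_cases[OF Suc.prems])
  obtain a' b' where ab': "b = a' + (v ^^ k) b'" "a' \<in> G k" "b' \<in> I" using Suc.IH[OF ab(3)] by blast
  then have "x = (a + v a') + (v ^^ Suc k) b'"
    using ab cideal_carrier[OF I_cideal] by (simp add: v_add G_carrier)
  moreover have "a + v a' \<in> G (Suc k)" using ab ab' by (auto simp: G.simps(2))
  ultimately show ?case using ab' by blast
qed

text \<open>The only new summand of \<open>G (Suc m)\<close> is the image of \<open>I\<close> under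
  \<open>v ^^ m\<close>, which is zero. Hence \<open>G m\<close> is stable under \<open>v\<close>,
  and simplicity applies.\<close>

lemma G_m: "G m = K"
proof -
  have "v x \<in> G m" if x: "x \<in> G m" for x
  proof -
    obtain a b where "v x = a + (v ^^ m) b" "a \<in> G m" "b \<in> I" using G_last[OF v_G[OF x]] by blast
    then show ?thesis using v_pow_m cideal_carrier[OF I_cideal] by simp
  qed
  then have "G m = {0} \<or> G m = K" using operator_simple[OF G_cideal] by blast
  moreover have "I \<subseteq> G m" using I_G m_ge_2 by (cases m) auto
  ultimately show ?thesis using I_nonzero subspace_0[OF cideal_subspace[OF I_cideal]] by blast
qed

section \<open>The length of the chain\<close>

definition N :: nat where "N = (LEAST k. G k = K)"

lemma G_N: "G N = K"
  unfolding N_def by (rule LeastI[of _ m], rule G_m)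

lemma N_le_m: "N \<le> m"
  unfolding N_def by (rule Least_le, rule G_m)

lemma G_less_N: "k < N \<Longrightarrow> G k \<noteq> K"
  unfolding N_def by (rule not_less_Least)

lemma K_nonzero: "K \<noteq> {0}"
proof
  assume K: "K = {0}"
  then have "commutator K K \<subseteq> {0}" by (intro commutator_subset) auto
  then show False using nonabelian span_zero unfolding commutator_def by blast
qed

lemma N_ge_2: "N \<ge> 2"
proof -
  have "N \<noteq> 0" using G_N K_nonzero by (metis G.simps(1))
  moreover have "N \<noteq> Suc 0"
  proof
    assume "N = Suc 0"
    then have "I = K" using G_N G_1 by simp
    then have "K \<subseteq> {0}" using perfect[of "{0}"] I_abelian by auto
    then show False using K_nonzero by auto
  qed
  ultimately show ?thesis by simp
qed

text \<open>The operator \<open>v\<close> maps each quotient \<open>G (Suc k) / G k\<close> onto the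
  next one. Pulling \<open>J\<close> back along \<open>v\<close> therefore reduces the claim to the
  layer below, and finally to the minimality of \<open>I\<close>.\<close>

lemma G_irreducible:
  assumes "cideal J" "G k \<subseteq> J" "J \<subseteq> G (Suc k)"
  shows "J = G k \<or> J = G (Suc k)"
  using assms
proof (induction k arbitrary: J)
  case 0
  then show ?case using I_minimal by (auto simp: G_1)
next
  case (Suc k)
  define J' where "J' = {b \<in> G (Suc k). v b \<in> J}"
  note sJ = cideal_subspace[OF Suc.prems(1)]
  have [simp]: "x \<in> K" if "x \<in> G (Suc k)" for x using that G_carrier by blast
  have "cideal J'"
  proof (rule cidealI)
    fix x y assume x: "x \<in> K" and y: "y \<in> J'"
    have "v \<langle>x, y\<rangle> = \<langle>c x, v y\<rangle> + \<langle>v x, y\<rangle>" using x y by (simp add: J'_def v_brk)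
    moreover have "\<langle>c x, v y\<rangle> \<in> J" using cideal_right[OF Suc.prems(1)] x y by (simp add: J'_def)
    moreover have "\<langle>v x, y\<rangle> \<in> J" using G_right[of "v x" y "Suc k"] x y Suc.prems(2) by (auto simp: J'_def)
    ultimately show "\<langle>x, y\<rangle> \<in> J'" using x y G_right[of x y "Suc k"] subspace_add[OF sJ] by (simp add: J'_def)
  qed (auto simp: J'_def subspace_0[OF sJ] subspace_add[OF sJ] subspace_scale[OF sJ] v_add v_scl v_c
      G_add G_scl G_c cideal_c[OF Suc.prems(1)])
  moreover have "G k \<subseteq> J'" using G_mono_Suc v_G Suc.prems(2) by (auto simp: J'_def)
  ultimately have "J' = G k \<or> J' = G (Suc k)" by (intro Suc.IH) (auto simp: J'_def)
  then show ?case
  proof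
    assume *: "J' = G k"
    have "x \<in> G (Suc k)" if x: "x \<in> J" for x
    proof -
      obtain a b where ab: "x = a + v b" "a \<in> I" "b \<in> G (Suc k)"
        using x Suc.prems(3) G.simps(2)[of "Suc k"] by blast
      have "a \<in> J" using I_G Suc.prems(2) ab by blast
      then have "v b \<in> J" using subspace_diff[OF sJ x, of a] ab by simp
      then have "b \<in> G k" using ab * by (auto simp: J'_def)
      then show ?thesis using ab by (auto simp: G.simps(2))
    qed
    then show ?thesis using Suc.prems(2) by blast
  next
    assume *: "J' = G (Suc k)"
    have "x \<in> J" if x: "x \<in> G (Suc (Suc k))" for x
    proof -
      obtain a b where ab: "x = a + v b" "a \<in> I" "b \<in> G (Suc k)"
        using x G.simps(2)[of "Suc k"] by blast
      have "a \<in> J" using I_G Suc.prems(2) ab by blast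
      moreover have "v b \<in> J" using ab * by (auto simp: J'_def)
      ultimately show ?thesis using ab subspace_add[OF sJ] by simp
    qed
    then show ?thesis using Suc.prems(3) by blast
  qed
qed

text \<open>The map induced by \<open>v\<close> from one layer to the next is injective: its kernel
  is a \<open>c\<close>-invariant ideal, hence trivial or the whole layer, and in the latter case
  the proper nonzero ideal \<open>G (Suc k)\<close> would be stable under \<open>v\<close>.\<close>

lemma v_reflects_G:
  assumes "Suc k < N" "b \<in> G (Suc k)" "v b \<in> G (Suc k)"
  shows "b \<in> G k"
proof -
  define J where "J = {b \<in> G (Suc k). v b \<in> G (Suc k)}"
  have [simp]: "x \<in> K" if "x \<in> G (Suc k)" for x using that G_carrier by blast
  have "cideal J"
  proof (rule cidealI)
    fix x y assume "x \<in> K" "y \<in> J"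
    then show "\<langle>x, y\<rangle> \<in> J" by (simp add: J_def v_brk G_right G_add)
  qed (auto simp: J_def G_add G_scl v_add v_scl v_c G_c)
  moreover have "G k \<subseteq> J" using G_mono_Suc v_G by (auto simp: J_def)
  ultimately have "J = G k \<or> J = G (Suc k)" by (intro G_irreducible) (auto simp: J_def)
  moreover have "J \<noteq> G (Suc k)"
  proof
    assume "J = G (Suc k)"
    then have "v ` G (Suc k) \<subseteq> G (Suc k)" by (auto simp: J_def)
    then have "G (Suc k) = {0}" using operator_simple[OF G_cideal] G_less_N[OF assms(1)] by blast
    then show False using I_G[of k] I_nonzero subspace_0[OF cideal_subspace[OF I_cideal]] by blast
  qed
  ultimately show ?thesis using assms by (auto simp: J_def)
qed

text \<open>Descending induction from the top layer. The claim for the next layer puts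
  \<open>v \<langle>a, b\<rangle>\<close> into \<open>G (Suc k)\<close>, and
  \<open>v_reflects_G\<close> brings the bracket itself down to \<open>G k\<close>.\<close>

lemma radical_annihilates_layer:
  assumes "a \<in> G (N - 1)" "k < N" "b \<in> G (Suc k)"
  shows "\<langle>a, b\<rangle> \<in> G k"
proof -
  have "\<forall>a\<in>G (N - 1). \<forall>b\<in>G (Suc k). \<langle>a, b\<rangle> \<in> G k" if "k \<le> N - 1" for k
    using that
  proof (induction k rule: inc_induct)
    case base
    then show ?case using G_left[of _ _ "N - 1"] G_carrier by blast
  next
    case (step k)
    show ?case
    proof (intro ballI)
      fix a b assume ab: "a \<in> G (N - 1)" "b \<in> G (Suc k)"
      then have K: "a \<in> K" "b \<in> K" using G_carrier by auto
      have "v \<langle>a, b\<rangle> = \<langle>c a, v b\<rangle> + \<langle>v a, b\<rangle>" using K by (rule v_brk)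
      moreover have "\<langle>c a, v b\<rangle> \<in> G (Suc k)" using step.IH ab G_c v_G by blast
      moreover have "\<langle>v a, b\<rangle> \<in> G (Suc k)" using ab K by (simp add: G_right)
      ultimately have "v \<langle>a, b\<rangle> \<in> G (Suc k)" by (simp add: G_add)
      moreover have "\<langle>a, b\<rangle> \<in> G (Suc k)" using ab K by (simp add: G_right)
      ultimately show "\<langle>a, b\<rangle> \<in> G k" using v_reflects_G step.hyps by simp
    qed
  qed
  then show ?thesis using assms by simp
qed

text \<open>Induction on \<open>p\<close>, moving one \<open>v\<close> from the first argument to
  the second. The subtraction is truncated, so for \<open>p + q \<le> N\<close> the bracket
  vanishes.\<close>

lemma G_filtration:
  "\<lbrakk>a \<in> G p; b \<in> G q; p \<le> N; q \<le> N\<rbrakk> \<Longrightarrow> \<langle>a, b\<rangle> \<in> G (p + q - N)"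
proof (induction p arbitrary: a b q)
  case 0
  then show ?case using G_carrier by auto
next
  case (Suc p)
  then have K: "a \<in> K" "b \<in> K" using G_carrier by auto
  show ?case
  proof (cases "q = N")
    case True
    then show ?thesis using Suc.prems K by (simp add: G_left)
  next
    case False
    obtain a1 a2 where a: "a = a1 + v a2" "a1 \<in> G (Suc 0)" "a2 \<in> G p" "a1 \<in> K" "a2 \<in> K"
      by (rule G_Suc_cases[OF Suc.prems(1)])
    \<comment> \<open>For \<open>q < N\<close> the element \<open>b\<close> annihilates the bottom
      layer \<open>I\<close>, so only the summand \<open>v a2\<close> contributes.\<close>
    have "b \<in> G (N - 1)" using False Suc.prems G_mono[of q "N - 1"] by fastforce
    then have "\<langle>b, a1\<rangle> \<in> G 0" using radical_annihilates_layer[of b 0 a1] a N_ge_2 by simp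
    then have 1: "\<langle>a1, b\<rangle> = 0" using brk_anticomm[of a1 b] a K by simp
    have "\<langle>a2, b\<rangle> \<in> G (p + q - N)" using Suc.IH[of a2 b q] a Suc.prems by simp
    \<comment> \<open>When \<open>p + q < N\<close>, the truncated index is 0 and
      \<open>\<langle>a2, b\<rangle>\<close> is already zero.\<close>
    then have 2: "v \<langle>a2, b\<rangle> \<in> G (Suc p + q - N)"
      using v_G[of "\<langle>a2, b\<rangle>" "p + q - N"] by (cases "N \<le> p + q") (auto simp: Suc_diff_le)
    have 3: "\<langle>c a2, v b\<rangle> \<in> G (Suc p + q - N)"
      using Suc.IH[of "c a2" "v b" "Suc q"] a(3) Suc.prems False v_G G_c by simp
    have "\<langle>a, b\<rangle> = v \<langle>a2, b\<rangle> - \<langle>c a2, v b\<rangle>"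
      using a K 1 by (simp add: brk_add_left v_brk)
    then show ?thesis using G_diff 2 3 by simp
  qed
qed

text \<open>The quotient of \<open>K\<close> by \<open>G (N - 1)\<close> has trivial centre: the
  preimage of the centre is a \<open>c\<close>-invariant ideal, the top layer is irreducible, and an
  abelian quotient would contradict perfectness.\<close>

lemma radical_centralizer:
  assumes "z \<in> K" "\<And>x. x \<in> K \<Longrightarrow> \<langle>x, z\<rangle> \<in> G (N - 1)"
  shows "z \<in> G (N - 1)"
proof -
  define J where "J = {z \<in> K. \<forall>x\<in>K. \<langle>x, z\<rangle> \<in> G (N - 1)}"
  have "cideal J"
  proof (rule cidealI)
    fix x assume x: "x \<in> J"
    have "\<langle>y, c x\<rangle> \<in> G (N - 1)" if "y \<in> K" for y
    proof -
      obtain z where "z \<in> K" "y = c z" using c_surj \<open>y \<in> K\<close> by blast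
      then show ?thesis using x by (simp add: J_def G_c flip: c_brk)
    qed
    then show "c x \<in> J" using x by (simp add: J_def)
  next
    fix x y assume "x \<in> K" "y \<in> J"
    then show "\<langle>x, y\<rangle> \<in> J" by (simp add: J_def G_right)
  qed (auto simp: J_def brk_add_right brk_scl_right G_add G_scl)
  moreover have "G (N - 1) \<subseteq> J" using G_right G_carrier by (auto simp: J_def)
  moreover have "J \<subseteq> G (Suc (N - 1))" using N_ge_2 G_N by (auto simp: J_def)
  ultimately have "J = G (N - 1) \<or> J = G (Suc (N - 1))" by (rule G_irreducible)
  moreover have "J \<noteq> G (Suc (N - 1))"
  proof
    assume "J = G (Suc (N - 1))"
    then have "J = K" using N_ge_2 G_N by simp
    then have "K \<subseteq> G (N - 1)" by (intro perfect G_subspace) (auto simp: J_def)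
    then have "G (N - 1) = K" using G_carrier by blast
    then show False using G_less_N[of "N - 1"] N_ge_2 by simp
  qed
  ultimately show ?thesis using assms by (auto simp: J_def)
qed

text \<open>
  Modulo \<open>G (N - 1)\<close>, an element \<open>v \<alpha>\<close> with \<open>\<alpha> \<in> G (N - 1)\<close> satisfies both
  \<open>v [\<alpha>, b] = [v \<alpha>, b]\<close> and \<open>v [b, \<alpha>] = [c b, v \<alpha>]\<close>; antisymmetry then forces \<open>c\<close> to fix \<open>b\<close>.
\<close>

lemma c_top:
  assumes b: "b \<in> K" shows "c b - b \<in> G (N - 1)"
proof (rule radical_centralizer)
  fix x assume x: "x \<in> K"
  then have "x \<in> G (Suc (N - 1))" using G_N N_ge_2 by simp
  then obtain i y where iy: "x = i + v y" "i \<in> I" "y \<in> G (N - 1)" "y \<in> K" "i \<in> K"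
    using G_Suc_cases[of x "N - 1"] by metis
  have "i \<in> G (N - 1)" using iy(2) I_G[of "N - 2"] N_ge_2 by (auto simp: numeral_2_eq_2 Suc_diff_Suc)
  then have i: "\<langle>i, c b - b\<rangle> \<in> G (N - 1)" using b by (simp add: G_left c_diff)
  have "v \<langle>y, b\<rangle> + v \<langle>b, y\<rangle> = v (\<langle>y, b\<rangle> + \<langle>b, y\<rangle>)" using iy b by (simp add: v_add)
  also have "\<dots> = 0" using iy b brk_anticomm[of y b] by simp
  finally have "(\<langle>c y, v b\<rangle> + \<langle>v y, b\<rangle>) + (\<langle>c b, v y\<rangle> + \<langle>v b, y\<rangle>) = 0"
    using iy b by (simp add: v_brk)
  moreover have "\<langle>c b, v y\<rangle> = - \<langle>v y, c b\<rangle>" using iy b by (intro brk_anticomm) auto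
  ultimately have "\<langle>v y, c b - b\<rangle> = \<langle>c y, v b\<rangle> + \<langle>v b, y\<rangle>"
    using iy b by (simp add: brk_diff_right algebra_simps)
  moreover have "\<langle>c y, v b\<rangle> + \<langle>v b, y\<rangle> \<in> G (N - 1)" using iy b by (simp add: G_add G_left G_right G_c)
  ultimately show "\<langle>x, c b - b\<rangle> \<in> G (N - 1)"
    using i iy b by (simp add: brk_add_left G_add)
qed (use b in simp)

text \<open>Descending induction starting from \<open>c_top\<close>. The relation
  \<open>v c = \<zeta> c v\<close> raises the exponent by one for each layer further down, and
  \<open>v_reflects_G\<close> transfers the congruence back along \<open>v\<close>.\<close>

lemma c_layer:
  assumes "k < N" "a \<in> G (Suc k)"
  shows "c a - \<zeta> ^ (N - 1 - k) \<cdot> a \<in> G k"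
proof -
  have "\<forall>a\<in>G (Suc k). c a - \<zeta> ^ (N - 1 - k) \<cdot> a \<in> G k" if "k \<le> N - 1" for k
    using that
  proof (induction k rule: inc_induct)
    case base
    then show ?case using c_top G_carrier by auto
  next
    case (step k)
    show ?case
    proof
      fix a assume a: "a \<in> G (Suc k)"
      then have K: "a \<in> K" by (rule G_carrier)
      have e: "N - 1 - k = Suc (N - 1 - Suc k)" using step.hyps by simp
      have "v (c a - \<zeta> ^ (N - 1 - k) \<cdot> a) = \<zeta> \<cdot> (c (v a) - \<zeta> ^ (N - 1 - Suc k) \<cdot> v a)"
        using K unfolding e by (simp add: v_diff v_scl v_c scale_right_diff_distrib)
      moreover have "c (v a) - \<zeta> ^ (N - 1 - Suc k) \<cdot> v a \<in> G (Suc k)" using step.IH v_G[OF a] by blast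
      ultimately have "v (c a - \<zeta> ^ (N - 1 - k) \<cdot> a) \<in> G (Suc k)" by (simp add: G_scl)
      moreover have "c a - \<zeta> ^ (N - 1 - k) \<cdot> a \<in> G (Suc k)" using a by (simp add: G_diff G_c G_scl)
      ultimately show "c a - \<zeta> ^ (N - 1 - k) \<cdot> a \<in> G k" using v_reflects_G step.hyps by simp
    qed
  qed
  then show ?thesis using assms by simp
qed


end


section \<open>Eigenspaces of \<open>c\<close>\<close>

context taft_simple_operators
begin

text \<open>The index is a natural number, but \<open>E i\<close> depends only on \<open>i\<close>
  modulo \<open>m\<close>; in particular \<open>E m\<close> is \<open>E 0\<close>.\<close>

definition E :: "nat \<Rightarrow> 'a set" where
  "E i = {x \<in> K. c x = \<zeta> ^ i \<cdot> x}"

text \<open>The projection onto \<open>E i\<close>, as the average of the powers of \<open>c\<close>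
  against a character of the cyclic group of order \<open>m\<close>. In characteristic 0 the number
  \<open>m\<close> is invertible.\<close>

definition P :: "nat \<Rightarrow> 'a \<Rightarrow> 'a" where
  "P i x = inverse (of_nat m) \<cdot> (\<Sum>j<m. inverse \<zeta> ^ (i * j) \<cdot> (c ^^ j) x)"

lemma E_carrier: "x \<in> E i \<Longrightarrow> x \<in> K"
  by (simp add: E_def)

lemma E_subspace: "subspace (E i)"
  by (auto simp: subspace_def E_def c_add c_scl scale_right_distrib mult.commute)

lemma P_closed [simp]: "x \<in> K \<Longrightarrow> P i x \<in> K"
  unfolding P_def by (intro carrier_scl carrier_sum) simp

lemma P_add: "\<lbrakk>x \<in> K; y \<in> K\<rbrakk> \<Longrightarrow> P i (x + y) = P i x + P i y"
  by (simp add: P_def c_pow_add scale_right_distrib sum.distrib)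

lemma P_scl: "x \<in> K \<Longrightarrow> P i (s \<cdot> x) = s \<cdot> P i x"
  by (simp add: P_def c_pow_scl scale_sum_right mult.commute mult.left_commute)

lemma P_0 [simp]: "P i 0 = 0"
  using P_add[of 0 0 i] by simp

lemma P_diff: "\<lbrakk>x \<in> K; y \<in> K\<rbrakk> \<Longrightarrow> P i (x - y) = P i x - P i y"
  using P_add[of "x - y" y i] by (simp add: algebra_simps)

lemma P_sum: "(\<And>j. j \<in> A \<Longrightarrow> f j \<in> K) \<Longrightarrow> P i (\<Sum>j\<in>A. f j) = (\<Sum>j\<in>A. P i (f j))"
  by (induction A rule: infinite_finite_induct) (auto simp: P_add)

lemma G_c_pow: "x \<in> G k \<Longrightarrow> (c ^^ j) x \<in> G k"
  by (induction j) (auto simp: G_c)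

lemma P_G: "x \<in> G k \<Longrightarrow> P i x \<in> G k"
  unfolding P_def by (intro G_scl G_sum G_c_pow)

lemma c_P: assumes x: "x \<in> K" shows "c (P i x) = \<zeta> ^ i \<cdot> P i x"
proof -
  define f where "f j = inverse \<zeta> ^ (i * j) \<cdot> (c ^^ j) x" for j
  have f: "f j \<in> K" for j using x by (simp add: f_def)
  have "\<zeta> ^ i * inverse \<zeta> ^ (i * Suc j) = inverse \<zeta> ^ (i * j)" for j
    by (simp add: power_add power_inverse)
  then have cf: "c (f j) = \<zeta> ^ i \<cdot> f (Suc j)" for j
    using x by (simp add: f_def c_scl del: mult_Suc_right)
  have "inverse \<zeta> ^ (i * m) = 1"
    by (simp add: power_inverse power_mult mult.commute[of i m])
  \<comment> \<open>Both the weights and the powers of \<open>c\<close> have period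
    \<open>m\<close>, so shifting the index permutes the summands cyclically.\<close>
  then have "f m = f 0" using x by (simp add: f_def c_pow_m)
  then have "(\<Sum>j<m. f (Suc j)) = (\<Sum>j<m. f j)"
    using sum.lessThan_Suc_shift[of f m] sum.lessThan_Suc[of f m] by simp
  then have "c (\<Sum>j<m. f j) = \<zeta> ^ i \<cdot> (\<Sum>j<m. f j)"
    using f by (simp add: c_sum cf flip: scale_sum_right)
  then show ?thesis
    using f unfolding P_def f_def[symmetric] by (simp add: c_scl mult.commute)
qed

lemma P_E: "x \<in> K \<Longrightarrow> P i x \<in> E i"
  by (simp add: E_def c_P)

lemma P_c: "x \<in> K \<Longrightarrow> P i (c x) = \<zeta> ^ i \<cdot> P i x"
proof -
  assume x: "x \<in> K"
  have "P i (c x) = c (P i x)"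
    using x by (simp add: P_def c_scl c_sum funpow_swap1)
  then show ?thesis using c_P[OF x] by simp
qed

text \<open>Moving \<open>c ^^ j\<close> past \<open>v\<close> costs the factor
  \<open>inverse \<zeta> ^ j\<close>, which shifts the index of the projection by one.\<close>

lemma P_v: assumes x: "x \<in> K" shows "P i (v x) = v (P (Suc i) x)"
proof -
  have "(c ^^ j) (v x) = inverse \<zeta> ^ j \<cdot> v ((c ^^ j) x)" for j
    by (induction j) (use x in \<open>auto simp: c_scl c_v mult.commute\<close>)
  then show ?thesis using x by (simp add: P_def v_scl v_sum power_add mult.commute)
qed

lemma P_id: "x \<in> E i \<Longrightarrow> P i x = x"
proof -
  assume x: "x \<in> E i"
  have "(c ^^ j) x = \<zeta> ^ (i * j) \<cdot> x" for j
    by (induction j) (use x in \<open>auto simp: E_def c_scl power_add mult.commute\<close>)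
  then have "inverse \<zeta> ^ (i * j) \<cdot> (c ^^ j) x = x" for j
    by (simp add: power_inverse)
  then have "P i x = inverse (of_nat m) \<cdot> of_nat m \<cdot> x"
    unfolding P_def using sum_constant_scale[of x "{..<m}"] by simp
  then show ?thesis using m_ge_2 by simp
qed

lemma P_other:
  assumes "x \<in> E j" "i < m" "j < m" "i \<noteq> j" shows "P i x = 0"
proof -
  have "\<zeta> ^ i \<cdot> P i x = P i (c x)" using assms P_c[of x i] by (simp add: E_def)
  also have "\<dots> = \<zeta> ^ j \<cdot> P i x" using assms by (simp add: E_def P_scl)
  finally have "(\<zeta> ^ i - \<zeta> ^ j) \<cdot> P i x = 0" by (simp add: scale_left_diff_distrib)
  then show ?thesis using primitive_root_power_inj[OF primitive assms(2,3)] assms(4) by auto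
qed

text \<open>Orthogonality of characters: after exchanging the sums, the geometric sum over
  \<open>i\<close> vanishes for every \<open>j\<close> except 0.\<close>

lemma sum_P: assumes x: "x \<in> K" shows "(\<Sum>i<m. P i x) = x"
proof -
  have geo: "(\<Sum>i<m. inverse \<zeta> ^ (i * j)) = (if j = 0 then of_nat m else 0)" if "j < m" for j
  proof (cases "j = 0")
    case False
    define w where "w = inverse \<zeta> ^ j"
    have "w \<noteq> 1"
      using primitive_root_power_inj[OF primitive that, of 0] False m_ge_2
      by (auto simp: w_def power_inverse)
    moreover have "w ^ m = 1" unfolding w_def
      by (metis \<zeta>_pow_m mult.commute inverse_1 power_inverse power_mult power_one)
    ultimately have "(\<Sum>i<m. w ^ i) = 0" using power_diff_1_eq[of w m] by simp
    then show ?thesis using False by (simp add: w_def mult.commute flip: power_mult)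
  qed simp
  have "(\<Sum>i<m. P i x) = inverse (of_nat m) \<cdot> (\<Sum>j<m. (\<Sum>i<m. inverse \<zeta> ^ (i * j)) \<cdot> (c ^^ j) x)"
    unfolding P_def scale_sum_left by (subst sum.swap) (rule scale_sum_right[symmetric])
  also have "(\<Sum>j<m. (\<Sum>i<m. inverse \<zeta> ^ (i * j)) \<cdot> (c ^^ j) x) = (\<Sum>j<m. if j = 0 then of_nat m \<cdot> x else 0)"
    by (intro sum.cong) (auto simp: geo)
  also have "\<dots> = of_nat m \<cdot> x" using m_ge_2 by simp
  finally show ?thesis using m_ge_2 by simp
qed

section \<open>Position of the eigenspaces in the filtration\<close>

lemma E_brk: "\<lbrakk>x \<in> E i; y \<in> E j\<rbrakk> \<Longrightarrow> \<langle>x, y\<rangle> \<in> E (i + j)"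
  by (simp add: E_def c_brk brk_scl_left brk_scl_right power_add mult.commute)

lemma E_Suc_v: "x \<in> E (Suc i) \<Longrightarrow> v x \<in> E i"
  by (simp add: E_def c_v v_scl)

lemma E_0_v: "x \<in> E 0 \<Longrightarrow> v x \<in> E (m - 1)"
  using E_Suc_v[of x "m - 1"] m_ge_2 by (simp add: E_def)

text \<open>On this layer \<open>c\<close> acts by \<open>\<zeta> ^ (N - 1 - k)\<close>. Since
  \<open>N \<le> m\<close>, both exponents are below \<open>m\<close> and the two eigenvalues
  differ, so the image of \<open>x\<close> in the layer is zero.\<close>

lemma E_layer:
  assumes x: "x \<in> E i" "x \<in> G (Suc k)" and k: "k < N" and i: "i < m" "i \<noteq> N - 1 - k"
  shows "x \<in> G k"
proof -
  define s where "s = \<zeta> ^ i - \<zeta> ^ (N - 1 - k)"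
  have "s \<noteq> 0"
    using primitive_root_power_inj[OF primitive i(1), of "N - 1 - k"] i(2) k N_le_m
    by (fastforce simp: s_def)
  moreover have "s \<cdot> x \<in> G k"
    using c_layer[OF k x(2)] x(1) by (simp add: E_def s_def scale_left_diff_distrib)
  ultimately show ?thesis using G_scl[of "s \<cdot> x" k "inverse s"] by simp
qed

text \<open>The layers with \<open>k \<ge> N - i\<close> carry exponents below \<open>i\<close>, so
  \<open>x\<close> drops through all of them. For \<open>N \<le> i\<close> this says that
  \<open>E i\<close> is zero.\<close>

lemma E_subset_G:
  assumes "x \<in> E i" "i < m" shows "x \<in> G (N - i)"
proof -
  have "N - i \<le> N" by simp
  then show ?thesis
  proof (induction rule: inc_induct)
    case base
    then show ?case using assms G_N by (simp add: E_carrier)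
  next
    case (step k)
    then show ?case using E_layer[OF assms(1), of k] assms(2) by simp
  qed
qed

text \<open>All layers below \<open>G k\<close> carry exponents larger than \<open>i\<close>, so
  \<open>x\<close> drops down to \<open>G 0\<close>.\<close>

lemma E_Int_G:
  assumes "x \<in> E i" "i < m" "x \<in> G k" "k + i < N" shows "x = 0"
  using assms(3,4)
  by (induction k) (use E_layer[OF assms(1)] assms(2) in auto)

section \<open>The quotient by \<open>G (N - 1)\<close>, realised as the subalgebra
  \<open>E 0\<close>\<close>

lemma minus_P_0: assumes "x \<in> K" shows "x - P 0 x \<in> G (N - 1)"
proof -
  have "{..<m} = insert 0 {1..<m}" using m_ge_2 by auto
  then have "x - P 0 x = (\<Sum>i\<in>{1..<m}. P i x)"
    using sum_P[OF assms] by (simp add: algebra_simps)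
  moreover have "P i x \<in> G (N - 1)" if "i \<in> {1..<m}" for i
    using E_subset_G[OF P_E[OF assms], of i] G_mono[of "N - i" "N - 1"] that by fastforce
  ultimately show ?thesis using G_sum[of "{1..<m}" "\<lambda>i. P i x"] by metis
qed

lemma P_0_radical: "x \<in> G (N - 1) \<Longrightarrow> P 0 x = 0"
  using E_Int_G[of "P 0 x" 0 "N - 1"] P_G P_E[of x 0] G_carrier N_ge_2 m_ge_2 by auto

text \<open>The kernel of \<open>P 0\<close> is the ideal \<open>G (N - 1)\<close>, and
  \<open>P 0\<close> is the identity on the subalgebra \<open>E 0\<close>; it is thus the quotient
  homomorphism.\<close>

lemma P_0_brk: assumes "x \<in> K" "y \<in> K" shows "P 0 \<langle>x, y\<rangle> = \<langle>P 0 x, P 0 y\<rangle>"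
proof -
  have "\<langle>x, y\<rangle> - \<langle>P 0 x, P 0 y\<rangle> = \<langle>x - P 0 x, y\<rangle> + \<langle>P 0 x, y - P 0 y\<rangle>"
    using assms by (simp add: brk_diff_left brk_diff_right)
  also have "\<dots> \<in> G (N - 1)"
    using assms minus_P_0 by (intro G_add G_left G_right) auto
  finally have "P 0 (\<langle>x, y\<rangle> - \<langle>P 0 x, P 0 y\<rangle>) = 0" by (rule P_0_radical)
  moreover have "P 0 \<langle>P 0 x, P 0 y\<rangle> = \<langle>P 0 x, P 0 y\<rangle>"
    using E_brk[OF P_E P_E, of x y 0 0] assms by (intro P_id) simp
  ultimately show ?thesis using assms by (simp add: P_diff)
qed

lemma E_0_nonabelian: "\<exists>x\<in>E 0. \<exists>y\<in>E 0. \<langle>x, y\<rangle> \<noteq> 0"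
proof (rule ccontr)
  assume "\<not> ?thesis"
  then have *: "\<langle>x, y\<rangle> = 0" if "x \<in> E 0" "y \<in> E 0" for x y using that by blast
  have "\<langle>x, y\<rangle> \<in> G (N - 1)" if "x \<in> K" "y \<in> K" for x y
    using minus_P_0[of "\<langle>x, y\<rangle>"] that *[OF P_E P_E] by (simp add: P_0_brk)
  then have "K \<subseteq> G (N - 1)" by (intro perfect G_subspace)
  then have "G (N - 1) = K" using G_carrier by blast
  then show False using G_less_N[of "N - 1"] N_ge_2 by simp
qed

section \<open>The operator \<open>v\<close> between the eigenspaces\<close>

lemma v_inj_E:
  assumes "x \<in> E (Suc i)" "Suc i < m" "v x = 0" shows "x = 0"
proof (cases "Suc i < N")
  case True
  then have e: "N - Suc i = Suc (N - Suc (Suc i))" by simp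
  have "x \<in> G (Suc (N - Suc (Suc i)))" using E_subset_G[OF assms(1,2)] by (simp only: e)
  then have "x \<in> G (N - Suc (Suc i))" using v_reflects_G True assms(3) by simp
  then show ?thesis using E_Int_G[OF assms(1,2)] True by simp
next
  case False
  then show ?thesis using E_subset_G[OF assms(1,2)] by simp
qed

text \<open>Write \<open>y = a + v b\<close> with \<open>a \<in> I\<close>. For
  \<open>Suc i < N\<close> the bottom layer has no component in \<open>E i\<close>, so applying
  \<open>P i\<close> removes \<open>a\<close> and turns \<open>b\<close> into an
  eigenvector.\<close>

lemma v_surj_E:
  assumes "y \<in> E i" "Suc i < N" shows "\<exists>x\<in>E (Suc i). v x = y"
proof -
  have i: "i < m" using assms N_le_m by simp
  have e: "N - i = Suc (N - Suc i)" using assms by simp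
  have "y \<in> G (Suc (N - Suc i))" using E_subset_G[OF assms(1) i] by (simp only: e)
  then obtain a b where ab: "y = a + v b" "a \<in> G (Suc 0)" "b \<in> K" "a \<in> K" using G_Suc_cases by metis
  have "P i a = 0" using E_Int_G[OF P_E[OF ab(4)] i, of "Suc 0"] P_G[OF ab(2)] assms by simp
  then have "y = v (P (Suc i) b)" using P_id[OF assms(1)] ab by (simp add: P_add P_v)
  then show ?thesis using P_E[OF ab(3)] by blast
qed

lemma v_pow_E: "x \<in> E (i + j) \<Longrightarrow> (v ^^ i) x \<in> E j"
  by (induction i arbitrary: j) (auto intro: E_Suc_v)

lemma v_pow_inj_E: "\<lbrakk>x \<in> E i; i < m; (v ^^ i) x = 0\<rbrakk> \<Longrightarrow> x = 0"
proof (induction i arbitrary: x)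
  case (Suc i)
  then have "v x = 0" using Suc.IH[of "v x"] E_Suc_v by (simp add: funpow_swap1)
  then show ?case using Suc.prems v_inj_E by blast
qed simp

lemma v_pow_surj_E: "\<lbrakk>y \<in> E 0; i < N\<rbrakk> \<Longrightarrow> \<exists>x\<in>E i. (v ^^ i) x = y"
proof (induction i)
  case (Suc i)
  then obtain x where "x \<in> E i" "(v ^^ i) x = y" by auto
  moreover obtain z where "z \<in> E (Suc i)" "v z = x" using v_surj_E[OF \<open>x \<in> E i\<close> Suc.prems(2)] by blast
  ultimately show ?case by (auto simp: funpow_swap1 intro!: bexI[of _ z])
qed auto

text \<open>Cyclically, \<open>v x\<close> lies in \<open>E (m - 1)\<close>, where
  \<open>v ^^ (m - 1)\<close> is injective; but this power sends \<open>v x\<close> to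
  \<open>(v ^^ m) x = 0\<close>.\<close>

lemma v_E_0: "x \<in> E 0 \<Longrightarrow> v x = 0"
proof -
  assume x: "x \<in> E 0"
  have "(v ^^ (m - 1)) (v x) = (v ^^ m) x"
    using m_ge_2 by (cases m) (auto simp: funpow_swap1)
  also have "\<dots> = 0" using v_pow_m E_carrier x by blast
  finally show ?thesis using v_pow_inj_E E_0_v[OF x] m_ge_2 by simp
qed

text \<open>The eigenvectors lie in \<open>G (N - i)\<close> and \<open>G (N - j)\<close>, so the
  filtration index of the bracket is 0.\<close>

lemma brk_E_eq_0:
  assumes "x \<in> E i" "y \<in> E j" "i < m" "j < m" "N \<le> i + j" shows "\<langle>x, y\<rangle> = 0"
proof -
  have "\<langle>x, y\<rangle> \<in> G ((N - i) + (N - j) - N)"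
    using assms by (intro G_filtration E_subset_G) auto
  moreover have "(N - i) + (N - j) - N = 0" using assms(5) by simp
  ultimately show ?thesis by simp
qed

text \<open>In the iterated quantum Leibniz rule only the term with \<open>k\<close> copies of
  \<open>v\<close> on \<open>a\<close> and \<open>l\<close> copies on \<open>b\<close> survives,
  since \<open>v\<close> kills \<open>E 0\<close>. The quantum Pascal rule identifies its
  coefficient.\<close>

lemma v_pow_brk:
  "\<lbrakk>a \<in> E k; b \<in> E l; k + l < m\<rbrakk> \<Longrightarrow>
    (v ^^ (k + l)) \<langle>a, b\<rangle> = q_binom \<zeta> (k + l) k \<cdot> \<langle>(v ^^ k) a, (v ^^ l) b\<rangle>"
proof (induction "k + l" arbitrary: k l a b)
  case 0
  then show ?case by (simp add: q_binom_def)
next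
  case (Suc n)
  have K: "a \<in> K" "b \<in> K" using Suc.prems E_carrier by auto
  have v: "v \<langle>a, b\<rangle> = \<zeta> ^ k \<cdot> \<langle>a, v b\<rangle> + \<langle>v a, b\<rangle>"
    using K Suc.prems by (simp add: v_brk E_def brk_scl_left)
  have pow: "(v ^^ (k + l)) \<langle>a, b\<rangle> = (v ^^ n) (v \<langle>a, b\<rangle>)"
    by (simp add: funpow_swap1 flip: Suc.hyps(2))
  consider (l) l' where "k = 0" "l = Suc l'" | (k) k' where "k = Suc k'" "l = 0"
    | (both) k' l' where "k = Suc k'" "l = Suc l'"
    proof (cases k; cases l)
    qed (use Suc.hyps(2) that in auto)
  then show ?case
  proof cases
    case l
    have "(v ^^ n) \<langle>a, v b\<rangle> = q_binom \<zeta> n 0 \<cdot> \<langle>a, (v ^^ l') (v b)\<rangle>"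
      using Suc.hyps(1)[of 0 l' a "v b"] Suc.prems Suc.hyps(2) l E_Suc_v by simp
    \<comment> \<open>Here \<open>k = 0\<close>, so \<open>a\<close> lies in \<open>E 0\<close> and
      the second Leibniz term disappears.\<close>
    moreover have "v a = 0" using Suc.prems l v_E_0 by blast
    ultimately show ?thesis using pow v K l by (simp add: q_binom_def funpow_swap1)
  next
    case k
    have "(v ^^ n) \<langle>v a, b\<rangle> = q_binom \<zeta> n n \<cdot> \<langle>(v ^^ k') (v a), b\<rangle>"
      using Suc.hyps(1)[of k' 0 "v a" b] Suc.prems Suc.hyps(2) k E_Suc_v by simp
    moreover have "v b = 0" using Suc.prems k v_E_0 by blast
    ultimately show ?thesis using pow v K k by (simp add: q_binom_def funpow_swap1)
  next
    case both
    have n: "n = Suc k' + l'" "n = k' + Suc l'" using Suc.hyps(2) both by auto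
    have 1: "(v ^^ n) \<langle>a, v b\<rangle> = q_binom \<zeta> (Suc k' + l') (Suc k') \<cdot> \<langle>(v ^^ k) a, (v ^^ l) b\<rangle>"
      using Suc.hyps(1)[of "Suc k'" l' a "v b"] Suc.prems n both E_Suc_v by (simp add: funpow_swap1)
    have 2: "(v ^^ n) \<langle>v a, b\<rangle> = q_binom \<zeta> (k' + Suc l') k' \<cdot> \<langle>(v ^^ k) a, (v ^^ l) b\<rangle>"
      using Suc.hyps(1)[of k' "Suc l'" "v a" b] Suc.prems n both E_Suc_v by (simp add: funpow_swap1)
    have "(v ^^ (k + l)) \<langle>a, b\<rangle> = \<zeta> ^ k \<cdot> (v ^^ n) \<langle>a, v b\<rangle> + (v ^^ n) \<langle>v a, b\<rangle>"
      using pow v K by (simp add: v_pow_add v_pow_scl)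
    also have "\<dots> = (\<zeta> ^ k * q_binom \<zeta> (Suc k' + l') (Suc k') + q_binom \<zeta> (k' + Suc l') k')
        \<cdot> \<langle>(v ^^ k) a, (v ^^ l) b\<rangle>"
      unfolding 1 2 by (simp only: scale_left_distrib scale_scale)
    also have "\<dots> = q_binom \<zeta> (k + l) k \<cdot> \<langle>(v ^^ k) a, (v ^^ l) b\<rangle>"
      using q_binom_pascal[OF primitive, of k' l'] Suc.prems(3) both by simp
    finally show ?thesis .
  qed
qed

text \<open>If \<open>N < m\<close>, brackets of total index \<open>N\<close> vanish by the
  filtration, while applying \<open>v ^^ N\<close> yields a nonzero quantum binomial coefficient
  times a bracket in \<open>E 0\<close> that can be chosen nonzero.\<close>

lemma N_eq_m: "N = m"
proof (rule ccontr)
  assume "N \<noteq> m"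
  then have N: "N < m" using N_le_m by simp
  obtain x y where xy: "x \<in> E 0" "y \<in> E 0" "\<langle>x, y\<rangle> \<noteq> 0" using E_0_nonabelian by blast
  \<comment> \<open>The noncommuting pair is lifted to indices 1 and \<open>N - 1\<close>, both
    below \<open>N\<close>, whose sum is exactly \<open>N\<close>.\<close>
  obtain a where a: "a \<in> E 1" "(v ^^ 1) a = x" using v_pow_surj_E[OF xy(1), of 1] N_ge_2 by auto
  obtain b where b: "b \<in> E (N - 1)" "(v ^^ (N - 1)) b = y" using v_pow_surj_E[OF xy(2), of "N - 1"] N_ge_2 by auto
  have e: "1 + (N - 1) = N" using N_ge_2 by simp
  have "\<langle>a, b\<rangle> = 0" using brk_E_eq_0[OF a(1) b(1)] N_ge_2 N by simp
  then have "q_binom \<zeta> (1 + (N - 1)) 1 \<cdot> \<langle>x, y\<rangle> = 0"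
    using v_pow_brk[OF a(1) b(1)] N e a b by simp
  moreover have "q_binom \<zeta> (1 + (N - 1)) 1 \<noteq> 0"
    using q_binom_eq[OF primitive, of 1 "N - 1"] q_fact_nonzero[OF primitive] N e by simp
  ultimately show False using xy by simp
qed

end


section \<open>The action of the free algebra\<close>

lemma free_ring_simps [simp]:
  "carrier (ring_of_type_algebra :: 'r::ring_1 ring) = UNIV"
  "monoid.mult (ring_of_type_algebra :: 'r::ring_1 ring) = (*)"
  "one (ring_of_type_algebra :: 'r::ring_1 ring) = 1"
  "ring.zero (ring_of_type_algebra :: 'r::ring_1 ring) = 0"
  "ring.add (ring_of_type_algebra :: 'r::ring_1 ring) = (+)"
  by (simp_all add: ring_of_type_algebra_def)

lemma ring_of_type_algebra_ring: "ring (ring_of_type_algebra :: 'r::ring_1 ring)"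
proof -
  have "\<exists>y. x + y = 0" for x :: 'r using add.right_inverse by blast
  moreover have "\<exists>y. x + y = 0 \<and> y + x = 0" for x :: 'r by (rule exI[of _ "- x"]) simp
  ultimately show ?thesis unfolding ring_of_type_algebra_def
    by unfold_locales (auto simp: algebra_simps Units_def)
qed

section \<open>Classes of the free algebra in the Taft algebra\<close>

lemma taft_ideal_ideal: "ideal (taft_ideal m \<zeta>) free_ring"
  unfolding taft_ideal_def Let_def by (rule ring.genideal_ideal[OF ring_of_type_algebra_ring]) simp

lemma taft_class_hom: "taft_class m \<zeta> \<in> ring_hom free_ring (taft_algebra m \<zeta>)"
  using ideal.rcos_ring_hom[OF taft_ideal_ideal]
  by (simp add: taft_class_def[abs_def] taft_algebra_def)

lemma taft_class_closed [simp]: "taft_class m \<zeta> p \<in> carrier (taft_algebra m \<zeta>)"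
  using ring_hom_closed[OF taft_class_hom, of p] by simp

lemma taft_class_add: "taft_class m \<zeta> (p + q) = taft_class m \<zeta> p \<oplus>\<^bsub>taft_algebra m \<zeta>\<^esub> taft_class m \<zeta> q"
  using ring_hom_add[OF taft_class_hom, of p q] by simp

lemma taft_class_mult: "taft_class m \<zeta> (p * q) = taft_class m \<zeta> p \<otimes>\<^bsub>taft_algebra m \<zeta>\<^esub> taft_class m \<zeta> q"
  using ring_hom_mult[OF taft_class_hom, of p q] by simp

lemma taft_class_one: "taft_class m \<zeta> 1 = \<one>\<^bsub>taft_algebra m \<zeta>\<^esub>"
  using ring_hom_one[OF taft_class_hom, of m \<zeta>] by simp

lemma taft_class_cases:
  assumes "h \<in> carrier (taft_algebra m \<zeta>)" obtains p where "h = taft_class m \<zeta> p"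
  using assms that unfolding taft_algebra_def FactRing_def A_RCOSETS_def' taft_class_def by auto

lemma taft_class_eq: assumes "q \<in> taft_class m \<zeta> p" shows "taft_class m \<zeta> q = taft_class m \<zeta> p"
proof -
  interpret ideal "taft_ideal m \<zeta>" free_ring by (rule taft_ideal_ideal)
  show ?thesis using a_repr_independence[of q "taft_ideal m \<zeta>" p] assms a_subgroup by (simp add: taft_class_def)
qed

lemma taft_class_self: "p \<in> taft_class m \<zeta> p"
proof -
  interpret ideal "taft_ideal m \<zeta>" free_ring by (rule taft_ideal_ideal)
  show ?thesis using a_rcos_self[of p] by (simp add: taft_class_def)
qed

lemma taft_class_eqI: assumes "p - q \<in> taft_ideal m \<zeta>" shows "taft_class m \<zeta> p = taft_class m \<zeta> q"
proof -
  interpret ideal "taft_ideal m \<zeta>" free_ring by (rule taft_ideal_ideal)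
  have "(p - q) + q \<in> taft_class m \<zeta> q"
    using a_rcosI[of "p - q" "taft_ideal m \<zeta>" q] assms by (simp add: taft_class_def)
  then show ?thesis by (simp add: taft_class_eq)
qed

lemma taft_ideal_generators:
  "free_word word_c ^ m - 1 \<in> taft_ideal m \<zeta>"
  "free_word word_v ^ m \<in> taft_ideal m \<zeta>"
  "free_word word_v * free_word word_c - free_const \<zeta> * free_word word_c * free_word word_v \<in> taft_ideal m \<zeta>"
  unfolding taft_ideal_def Let_def
  by (rule subsetD[OF ring.genideal_self[OF ring_of_type_algebra_ring]]; simp)+

section \<open>Words as a basis of the free algebra\<close>

lemma free_word_0 [simp]: "free_word 0 = 1"
  by (simp add: free_word_def)

lemma free_word_add: "free_word (u + w) = free_word u * free_word w"
  by (simp add: free_word_def mult_single)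

lemma free_const_0 [simp]: "free_const 0 = 0"
  by (simp add: free_const_def)

lemma free_taft_sum: "p = (\<Sum>w\<in>Poly_Mapping.keys p. free_const (Poly_Mapping.lookup p w) * free_word w)"
proof (rule poly_mapping_eqI)
  fix u
  have "(\<Sum>w\<in>Poly_Mapping.keys p. Poly_Mapping.lookup (free_const (Poly_Mapping.lookup p w) * free_word w) u)
      = (\<Sum>w\<in>Poly_Mapping.keys p. if w = u then Poly_Mapping.lookup p u else 0)"
    by (intro sum.cong) (auto simp: free_const_def free_word_def mult_single lookup_single)
  then show "Poly_Mapping.lookup p u = Poly_Mapping.lookup (\<Sum>w\<in>Poly_Mapping.keys p. free_const (Poly_Mapping.lookup p w) * free_word w) u"
    by (simp add: lookup_sum in_keys_iff)
qed

lemma letters_generators [simp]: "letters word_c = [Gen_c]" "letters word_v = [Gen_v]"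
  by (simp_all add: word_c_def word_v_def)

lemma free_comult_word: "free_comult (free_word w) = prod_list (map gen_comult (letters w))"
  by (simp add: free_comult_def free_word_def)

section \<open>The generator operators of a module Lie algebra\<close>

context taft_module_lie_algebra
begin

abbreviation cls :: "'f free_taft \<Rightarrow> 'f free_taft set" where "cls \<equiv> taft_class m \<zeta>"

definition c_op :: "'a \<Rightarrow> 'a" where "c_op = act L (cls (free_word word_c))"
definition v_op :: "'a \<Rightarrow> 'a" where "v_op = act L (cls (free_word word_v))"

lemma act_cls_closed [simp]: "x \<in> K \<Longrightarrow> act L (cls p) x \<in> K"
  by (rule act_closed) simp

lemma act_cls_add: "x \<in> K \<Longrightarrow> act L (cls (p + q)) x = act L (cls p) x + act L (cls q) x"
  by (simp add: taft_class_add act_add_left)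

lemma act_cls_mult: "x \<in> K \<Longrightarrow> act L (cls (p * q)) x = act L (cls p) (act L (cls q) x)"
  by (simp add: taft_class_mult act_mult)

lemma act_cls_1 [simp]: "x \<in> K \<Longrightarrow> act L (cls 1) x = x"
  by (simp add: taft_class_one act_one)

lemma act_cls_0 [simp]: "x \<in> K \<Longrightarrow> act L (cls 0) x = 0"
  using act_const[of x 0] by simp

lemma act_cls_sum: "x \<in> K \<Longrightarrow> act L (cls (\<Sum>i\<in>A. f i)) x = (\<Sum>i\<in>A. act L (cls (f i)) x)"
  by (induction A rule: infinite_finite_induct) (auto simp: act_cls_add)

lemma act_cls_power: "x \<in> K \<Longrightarrow> act L (cls (p ^ n)) x = (act L (cls p) ^^ n) x"
proof (induction n)
  case (Suc n)
  have "(act L (cls p) ^^ n) x \<in> K" using Suc.prems by (induction n) auto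
  then show ?case using Suc by (simp add: act_cls_mult)
qed simp

lemma act_word: "x \<in> K \<Longrightarrow> act L (cls (free_word (Word gs))) x = foldr (gen_op c_op v_op) gs x \<and>
    foldr (gen_op c_op v_op) gs x \<in> K"
proof (induction gs)
  case Nil
  then show ?case using free_word_0 by (simp flip: zero_taft_word_def)
next
  case (Cons g gs)
  have "free_word (Word (g # gs)) = free_word (Word [g]) * (free_word (Word gs) :: 'f free_taft)"
    by (simp add: plus_taft_word_def flip: free_word_add)
  moreover have "gen_op c_op v_op g = act L (cls (free_word (Word [g])))"
    by (cases g) (simp_all add: c_op_def v_op_def word_c_def word_v_def)
  ultimately show ?case using Cons by (simp add: act_cls_mult)
qed

text \<open>Brings the given action into the form \<open>free_op\<close>, through which the action
  on \<open>LB0\<close> is defined.\<close>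

lemma act_free_op: assumes x: "x \<in> K" shows "act L (cls p) x = free_op (scl L) c_op v_op p x"
proof -
  have "act L (cls p) x = act L (cls (\<Sum>w\<in>Poly_Mapping.keys p. free_const (Poly_Mapping.lookup p w) * free_word w)) x"
    by (subst free_taft_sum[of p]) rule
  also have "\<dots> = (\<Sum>w\<in>Poly_Mapping.keys p. Poly_Mapping.lookup p w \<cdot> act L (cls (free_word w)) x)"
    using x by (simp add: act_cls_sum act_cls_mult act_const)
  also have "\<dots> = free_op (scl L) c_op v_op p x"
    using act_word[OF x, of "letters _"] by (simp add: free_op_def)
  finally show ?thesis .
qed

lemma invariantI:
  assumes J: "subspace J" "J \<subseteq> K" "c_op ` J \<subseteq> J" "v_op ` J \<subseteq> J" shows "invariant J"
  unfolding invariant_def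
proof (intro ballI)
  fix h x assume h: "h \<in> carrier (taft_algebra m \<zeta>)" and x: "x \<in> J"
  obtain p where p: "h = cls p" using taft_class_cases[OF h] .
  have "foldr (gen_op c_op v_op) gs x \<in> J" for gs
  proof (induction gs)
    case (Cons g gs)
    then show ?case using J(3,4) by (cases g) auto
  qed (simp add: x)
  then have "free_op (scl L) c_op v_op p x \<in> J"
    unfolding free_op_def by (intro subspace_sum subspace_scale J(1))
  then show "act L h x \<in> J" using act_free_op[of x p] J(2) x p by auto
qed

lemma c_op_brk: assumes "x \<in> K" "y \<in> K" shows "c_op \<langle>x, y\<rangle> = \<langle>c_op x, c_op y\<rangle>"
  unfolding c_op_def using act_brk[OF assms, of "free_word word_c"]
  by (simp add: free_comult_word)

lemma v_op_brk: assumes "x \<in> K" "y \<in> K" shows "v_op \<langle>x, y\<rangle> = \<langle>c_op x, v_op y\<rangle> + \<langle>v_op x, y\<rangle>"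
proof -
  \<comment> \<open>The coefficient is a separate argument of \<open>?f\<close>: by additivity in
    it, the sum over the keys of the coproduct splits into its two terms.\<close>
  let ?f = "\<lambda>u s. s \<cdot> \<langle>act L (cls (free_word (fst u))) x, act L (cls (free_word (snd u))) y\<rangle>"
  have "v_op \<langle>x, y\<rangle> = (\<Sum>u\<in>Poly_Mapping.keys (gen_comult Gen_v :: 'f free_taft2). ?f u (Poly_Mapping.lookup (gen_comult Gen_v) u))"
    unfolding v_op_def using act_brk[OF assms, of "free_word word_v"]
    by (simp add: free_comult_word del: gen_comult.simps)
  also have "\<dots> = \<langle>c_op x, v_op y\<rangle> + \<langle>v_op x, y\<rangle>"
    unfolding gen_comult.simps
    by (subst setsum_keys_plus_distrib)
      (use assms in \<open>simp_all add: scale_left_distrib c_op_def v_op_def\<close>)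
  finally show ?thesis .
qed

lemma v_op_c_op: assumes "x \<in> K" shows "v_op (c_op x) = \<zeta> \<cdot> c_op (v_op x)"
proof -
  have "cls (free_word word_v * free_word word_c) = cls (free_const \<zeta> * free_word word_c * free_word word_v)"
    by (rule taft_class_eqI) (rule taft_ideal_generators)
  then have "act L (cls (free_word word_v * free_word word_c)) x
      = act L (cls (free_const \<zeta> * free_word word_c * free_word word_v)) x" by simp
  then show ?thesis using assms by (simp add: act_cls_mult act_const c_op_def v_op_def)
qed

lemma c_op_pow: assumes "x \<in> K" shows "(c_op ^^ m) x = x"
proof -
  have "cls (free_word word_c ^ m) = cls 1" by (rule taft_class_eqI) (rule taft_ideal_generators)
  then show ?thesis using assms act_cls_power[of x "free_word word_c" m] by (simp add: c_op_def)
qed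

lemma v_op_pow: assumes "x \<in> K" shows "(v_op ^^ m) x = 0"
proof -
  have "cls (free_word word_v ^ m) = cls 0" by (rule taft_class_eqI) (simp add: taft_ideal_generators)
  then show ?thesis using assms act_cls_power[of x "free_word word_v" m] by (simp add: v_op_def)
qed

text \<open>Homogeneity follows from the module axioms because constants are central in the free
  algebra and act as scalars.\<close>

lemma act_cls_scl: "x \<in> K \<Longrightarrow> act L (cls p) (s \<cdot> x) = s \<cdot> act L (cls p) x"
proof -
  assume x: "x \<in> K"
  have comm: "p * free_const s = free_const s * p"
  proof (subst (1 2) free_taft_sum[of p])
    show "(\<Sum>w\<in>Poly_Mapping.keys p. free_const (Poly_Mapping.lookup p w) * free_word w) * free_const s
      = free_const s * (\<Sum>w\<in>Poly_Mapping.keys p. free_const (Poly_Mapping.lookup p w) * free_word w)"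
      unfolding sum_distrib_left sum_distrib_right
      by (intro sum.cong) (simp_all add: free_const_def free_word_def mult_single mult.commute)
  qed
  have "act L (cls p) (s \<cdot> x) = act L (cls (p * free_const s)) x"
    using x by (simp add: act_cls_mult act_const)
  also have "\<dots> = s \<cdot> act L (cls p) x"
    unfolding comm using x by (simp add: act_cls_mult act_const)
  finally show ?thesis .
qed

end

lemma taft_operators_act:
  fixes L :: "('f::field_char_0, 'a::ab_group_add, 'z) taft_lie_scheme"
  assumes "taft_module_lie_algebra m \<zeta> L" "m \<ge> 2" "primitive_root m \<zeta>"
  shows "taft_operators L m \<zeta> (taft_module_lie_algebra.c_op m \<zeta> L) (taft_module_lie_algebra.v_op m \<zeta> L)"
proof -
  interpret taft_module_lie_algebra m \<zeta> L by fact
  show ?thesis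
  proof
    fix s x y assume x: "x \<in> K"
    show "c_op x \<in> K" "v_op x \<in> K" "c_op (s \<cdot> x) = s \<cdot> c_op x" "v_op (s \<cdot> x) = s \<cdot> v_op x"
      using x by (simp_all add: c_op_def v_op_def act_cls_scl)
    show "(c_op ^^ m) x = x" "(v_op ^^ m) x = 0" "v_op (c_op x) = \<zeta> \<cdot> c_op (v_op x)"
      using x by (rule c_op_pow v_op_pow v_op_c_op)+
    assume y: "y \<in> K"
    show "c_op (x + y) = c_op x + c_op y" "v_op (x + y) = v_op x + v_op y"
      using x y by (simp_all add: c_op_def v_op_def act_add_right)
    show "c_op \<langle>x, y\<rangle> = \<langle>c_op x, c_op y\<rangle>" "v_op \<langle>x, y\<rangle> = \<langle>c_op x, v_op y\<rangle> + \<langle>v_op x, y\<rangle>"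
      using x y by (rule c_op_brk v_op_brk)+
  qed fact+
qed


section \<open>Existence of a minimal abelian \<open>c\<close>-invariant ideal\<close>

context lie_algebra
begin

text \<open>By the Jacobi identity, bracketing with \<open>x\<close> is a derivation, and it keeps
  both factors in the ideal \<open>S\<close>.\<close>

lemma lie_ideal_commutator:
  assumes S: "lie_ideal S" shows "lie_ideal (commutator S S)"
proof -
  have SK: "a \<in> K" if "a \<in> S" for a using S that by (auto simp: lie_ideal_def)
  let ?C = "commutator S S"
  have sub: "subspace ?C" unfolding commutator_def by (rule subspace_span)
  have CK: "?C \<subseteq> K" using SK by (intro commutator_subset carrier_subspace) auto
  have "\<langle>x, y\<rangle> \<in> ?C" if x: "x \<in> K" and y: "y \<in> ?C" for x y
  proof -
    have "?C \<subseteq> {y \<in> K. \<langle>x, y\<rangle> \<in> ?C}"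
    proof (rule commutator_subset)
      show "subspace {y \<in> K. \<langle>x, y\<rangle> \<in> ?C}"
        using x sub by (auto simp: subspace_def brk_add_right brk_scl_right)
    next
      fix a b assume ab: "a \<in> S" "b \<in> S"
      then have K: "a \<in> K" "b \<in> K" using SK by auto
      have "\<langle>x, \<langle>a, b\<rangle>\<rangle> = - \<langle>a, \<langle>b, x\<rangle>\<rangle> - \<langle>b, \<langle>x, a\<rangle>\<rangle>"
        using jacobi[OF x K] by (simp add: algebra_simps eq_neg_iff_add_eq_0)
      moreover have "\<langle>a, \<langle>b, x\<rangle>\<rangle> \<in> ?C"
        using ab x by (intro brk_in_commutator lie_ideal_left[OF S])
      moreover have "\<langle>b, \<langle>x, a\<rangle>\<rangle> \<in> ?C"
        using ab x by (intro brk_in_commutator lie_ideal_right[OF S])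
      ultimately show "\<langle>a, b\<rangle> \<in> {y \<in> K. \<langle>x, y\<rangle> \<in> ?C}"
        using K by (simp add: subspace_diff[OF sub] subspace_neg[OF sub])
    qed
    then show ?thesis using y by blast
  qed
  then show ?thesis using sub CK by (auto simp: lie_ideal_def)
qed

lemma lie_ideal_derived_series: "lie_ideal S \<Longrightarrow> lie_ideal (derived_series S n)"
  by (induction n) (auto simp: lie_ideal_commutator)

text \<open>The last nonzero term of the derived series of a nonzero solvable ideal is
  abelian.\<close>

lemma nonzero_abelian_ideal:
  assumes "solvable_radical \<noteq> {0}"
  obtains A where "lie_ideal A" "A \<noteq> {0}" "\<And>x y. \<lbrakk>x \<in> A; y \<in> A\<rbrakk> \<Longrightarrow> \<langle>x, y\<rangle> = 0"
proof -
  \<comment> \<open>If every solvable ideal were zero, the span that defines the radical would be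
    zero.\<close>
  obtain S where S: "lie_ideal S" "solvable S" "S \<noteq> {0}"
  proof -
    have "\<exists>S. lie_ideal S \<and> solvable S \<and> S \<noteq> {0}"
    proof (rule ccontr)
      assume "\<not> ?thesis"
      then have "\<Union>{S. lie_ideal S \<and> solvable S} \<subseteq> {0}" by blast
      then have "span (\<Union>{S. lie_ideal S \<and> solvable S}) \<subseteq> {0}" by (rule span_minimal) simp
      then show False using assms span_zero unfolding solvable_radical_def by blast
    qed
    then show ?thesis using that by blast
  qed
  define n where "n = (LEAST n. derived_series S n = {0})"
  have n: "derived_series S n = {0}" unfolding n_def using S(2) unfolding solvable_def by (rule LeastI_ex)
  then obtain k where k: "n = Suc k" using S(3) by (cases n) auto
  have "derived_series S k \<noteq> {0}" using not_less_Least[of k "\<lambda>n. derived_series S n = {0}"] k n_def by auto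
  moreover have "\<langle>x, y\<rangle> = 0" if "x \<in> derived_series S k" "y \<in> derived_series S k" for x y
    using brk_in_commutator[OF that] n k by simp
  ultimately show ?thesis using that lie_ideal_derived_series[OF S(1)] by blast
qed

end

context taft_operators
begin

section \<open>Translates of an ideal under powers of \<open>c\<close>\<close>

lemma c_pow_surj:
  assumes "x \<in> K" obtains y where "y \<in> K" "x = (c ^^ n) y"
  using assms
proof (induction n arbitrary: x thesis)
  case (Suc n)
  obtain z where z: "z \<in> K" "x = c z" using c_surj[OF Suc.prems(2)] .
  obtain y where "y \<in> K" "z = (c ^^ n) y" using Suc.IH[OF _ z(1)] .
  then show ?case using Suc.prems(1)[of y] z by simp
qed auto

lemma lie_ideal_c_pow:
  assumes A: "lie_ideal A" shows "lie_ideal ((c ^^ n) ` A)"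
proof -
  have AK: "a \<in> K" if "a \<in> A" for a using A that by (auto simp: lie_ideal_def)
  have sA: "subspace A" using A by (simp add: lie_ideal_def)
  have "subspace ((c ^^ n) ` A)"
    unfolding subspace_def
  proof (intro conjI ballI allI)
    show "0 \<in> (c ^^ n) ` A" using subspace_0[OF sA] c_pow_0 by (metis imageI)
  next
    fix x y assume "x \<in> (c ^^ n) ` A" "y \<in> (c ^^ n) ` A"
    then show "x + y \<in> (c ^^ n) ` A"
      using AK subspace_add[OF sA] by (auto simp flip: c_pow_add)
  next
    fix s x assume "x \<in> (c ^^ n) ` A"
    then show "s \<cdot> x \<in> (c ^^ n) ` A"
      using AK subspace_scale[OF sA] by (auto simp flip: c_pow_scl)
  qed
  moreover have "\<langle>x, (c ^^ n) a\<rangle> \<in> (c ^^ n) ` A" if x: "x \<in> K" and a: "a \<in> A" for x a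
  proof -
    obtain y where "y \<in> K" "x = (c ^^ n) y" using c_pow_surj[OF x] .
    then show ?thesis using AK a lie_ideal_right[OF A] by (auto simp flip: c_pow_brk)
  qed
  ultimately show ?thesis using AK unfolding lie_ideal_def by auto
qed

text \<open>
  For a minimal abelian ideal \<open>A\<close>, distinct translates \<open>c\<^sup>i A\<close> meet trivially and hence commute,
  so the sum of the translates is still abelian.
\<close>

lemma nonzero_abelian_cideal:
  assumes "fin_dim" "solvable_radical \<noteq> {0}"
  obtains S where "cideal S" "S \<noteq> {0}" "\<And>x y. \<lbrakk>x \<in> S; y \<in> S\<rbrakk> \<Longrightarrow> \<langle>x, y\<rangle> = 0"
proof -
  obtain A0 where A0: "lie_ideal A0" "A0 \<noteq> {0}" "\<And>x y. \<lbrakk>x \<in> A0; y \<in> A0\<rbrakk> \<Longrightarrow> \<langle>x, y\<rangle> = 0"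
    using nonzero_abelian_ideal[OF assms(2)] by blast
  obtain A where A': "lie_ideal A \<and> A \<noteq> {0} \<and> A \<subseteq> A0"
    and A_min: "\<And>W. \<lbrakk>lie_ideal W \<and> W \<noteq> {0} \<and> W \<subseteq> A0; W \<subseteq> A\<rbrakk> \<Longrightarrow> W = A"
    by (rule minimal_subspace[OF assms(1), of "\<lambda>U. lie_ideal U \<and> U \<noteq> {0} \<and> U \<subseteq> A0" A0])
      (use A0 in \<open>auto simp: lie_ideal_def\<close>)
  then have A: "lie_ideal A" "A \<noteq> {0}" and ab: "\<And>x y. \<lbrakk>x \<in> A; y \<in> A\<rbrakk> \<Longrightarrow> \<langle>x, y\<rangle> = 0"
    using A0(3) by (auto simp: subset_iff)
  have AK: "a \<in> K" if "a \<in> A" for a using A that by (auto simp: lie_ideal_def)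
  have comm0: "\<langle>a, (c ^^ n) b\<rangle> = 0" if a: "a \<in> A" and b: "b \<in> A" for a b n
  proof -
    let ?W = "A \<inter> (c ^^ n) ` A"
    note cA = lie_ideal_c_pow[OF A(1), of n]
    have W: "lie_ideal ?W" using A(1) cA unfolding lie_ideal_def by (auto intro: subspace_inter)
    show ?thesis
    proof (cases "?W = {0}")
      case True
      have "\<langle>a, (c ^^ n) b\<rangle> \<in> (c ^^ n) ` A" using a b AK lie_ideal_right[OF cA] by blast
      moreover have "\<langle>a, (c ^^ n) b\<rangle> \<in> A" using a b AK lie_ideal_left[OF A(1)] by auto
      ultimately show ?thesis using True by blast
    next
      \<comment> \<open>Now \<open>A\<close> lies inside its own translate, so both arguments are
        images under \<open>c ^^ n\<close> of elements of the abelian ideal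
        \<open>A\<close>.\<close>
      case False
      then have "?W = A" using A_min[of ?W] W A' by blast
      then obtain a' where "a' \<in> A" "a = (c ^^ n) a'" using a by blast
      then show ?thesis using b ab[of a' b] AK by (simp flip: c_pow_brk)
    qed
  qed
  define U where "U = (\<Union>n. (c ^^ n) ` A)"
  have UK: "U \<subseteq> K" using AK by (auto simp: U_def)
  have comm: "\<langle>x, y\<rangle> = 0" if xy: "x \<in> U" "y \<in> U" for x y
  proof -
    have le: "\<langle>(c ^^ i) a, (c ^^ j) b\<rangle> = 0" if "i \<le> j" "a \<in> A" "b \<in> A" for i j a b
    proof -
      have "(c ^^ j) b = (c ^^ i) ((c ^^ (j - i)) b)"
        using that by (simp flip: funpow_add comp_apply[of "c ^^ i"])
      then have "\<langle>(c ^^ i) a, (c ^^ j) b\<rangle> = (c ^^ i) \<langle>a, (c ^^ (j - i)) b\<rangle>"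
        using that AK by (simp add: c_pow_brk)
      then show ?thesis using comm0 that by simp
    qed
    obtain i a j b where *: "x = (c ^^ i) a" "y = (c ^^ j) b" "a \<in> A" "b \<in> A"
      using xy by (auto simp: U_def)
    show ?thesis
    proof (cases "i \<le> j")
      case False
      then have "\<langle>y, x\<rangle> = 0" using le * by simp
      then show ?thesis using brk_anticomm[of x y] xy UK by auto
    qed (use le * in simp)
  qed
  have sub: "subspace (span U)" by (rule subspace_span)
  have SK: "span U \<subseteq> K" by (rule span_minimal[OF UK carrier_subspace])
  have c_span: "c x \<in> span U" if "x \<in> span U" for x
  proof -
    have "span U \<subseteq> {x \<in> K. c x \<in> span U}"
    proof (rule span_minimal)
      show "U \<subseteq> {x \<in> K. c x \<in> span U}"
      proof
        fix x assume x: "x \<in> U"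
        then obtain n a where "x = (c ^^ n) a" "a \<in> A" by (auto simp: U_def)
        then have "c x = (c ^^ Suc n) a" "a \<in> A" by auto
        then have "c x \<in> U" unfolding U_def by blast
        then show "x \<in> {x \<in> K. c x \<in> span U}" using x UK by (auto intro: span_base)
      qed
    qed (use sub in \<open>auto simp: subspace_def c_add c_scl\<close>)
    then show ?thesis using that by blast
  qed
  have brk_span: "\<langle>x, y\<rangle> \<in> span U" if x: "x \<in> K" and y: "y \<in> span U" for x y
  proof -
    have "span U \<subseteq> {y \<in> K. \<langle>x, y\<rangle> \<in> span U}"
    proof (rule span_minimal)
      show "U \<subseteq> {y \<in> K. \<langle>x, y\<rangle> \<in> span U}"
      proof
        fix y assume y: "y \<in> U"
        then obtain n where "y \<in> (c ^^ n) ` A" by (auto simp: U_def)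
        then have "\<langle>x, y\<rangle> \<in> (c ^^ n) ` A" using lie_ideal_right[OF lie_ideal_c_pow[OF A(1)] x] by blast
        then have "\<langle>x, y\<rangle> \<in> U" by (auto simp: U_def)
        then show "y \<in> {y \<in> K. \<langle>x, y\<rangle> \<in> span U}" using y UK by (auto intro: span_base)
      qed
    qed (use sub x in \<open>auto simp: subspace_def brk_add_right brk_scl_right\<close>)
    then show ?thesis using y by blast
  qed
  \<comment> \<open>Commutation passes from \<open>U\<close> to its span one argument at a
    time.\<close>
  have comm1: "\<langle>x, y\<rangle> = 0" if x: "x \<in> U" and y: "y \<in> span U" for x y
  proof -
    have "span U \<subseteq> {y \<in> K. \<langle>x, y\<rangle> = 0}"
      by (rule span_minimal) (use x UK comm in \<open>auto simp: subspace_def brk_add_right brk_scl_right\<close>)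
    then show ?thesis using y by blast
  qed
  have comm2: "\<langle>x, y\<rangle> = 0" if x: "x \<in> span U" and y: "y \<in> span U" for x y
  proof -
    have "span U \<subseteq> {x \<in> K. \<langle>x, y\<rangle> = 0}"
      by (rule span_minimal) (use y UK SK comm1 in \<open>auto simp: subspace_def brk_add_left brk_scl_left\<close>)
    then show ?thesis using x by blast
  qed
  have "cideal (span U)"
    using SK c_span brk_span by (intro cidealI) (auto simp: span_zero span_add span_scale)
  moreover have "span U \<noteq> {0}"
  proof -
    have "A \<subseteq> U" unfolding U_def by (auto intro!: exI[of _ 0])
    then show ?thesis using A span_superset[of U] subspace_0 lie_ideal_def by blast
  qed
  ultimately show ?thesis using that comm2 by blast
qed

lemma minimal_abelian_cideal:
  assumes "fin_dim" "solvable_radical \<noteq> {0}"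
  obtains I where "cideal I" "I \<noteq> {0}" "\<And>x y. \<lbrakk>x \<in> I; y \<in> I\<rbrakk> \<Longrightarrow> \<langle>x, y\<rangle> = 0"
    "\<And>J. \<lbrakk>cideal J; J \<subseteq> I\<rbrakk> \<Longrightarrow> J = {0} \<or> J = I"
proof -
  obtain S where S: "cideal S" "S \<noteq> {0}" "\<And>x y. \<lbrakk>x \<in> S; y \<in> S\<rbrakk> \<Longrightarrow> \<langle>x, y\<rangle> = 0"
    using nonzero_abelian_cideal[OF assms] by blast
  obtain I where I: "cideal I \<and> I \<noteq> {0} \<and> I \<subseteq> S"
    and min: "\<And>W. \<lbrakk>cideal W \<and> W \<noteq> {0} \<and> W \<subseteq> S; W \<subseteq> I\<rbrakk> \<Longrightarrow> W = I"
    by (rule minimal_subspace[OF assms(1), of "\<lambda>U. cideal U \<and> U \<noteq> {0} \<and> U \<subseteq> S" S])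
      (use S cideal_subspace cideal_carrier in auto)
  show ?thesis
  proof (rule that)
    show "\<langle>x, y\<rangle> = 0" if "x \<in> I" "y \<in> I" for x y using I S(3) that by blast
    show "J = {0} \<or> J = I" if "cideal J" "J \<subseteq> I" for J using min[of J] that I by blast
  qed (use I in auto)
qed

end

section \<open>The isomorphism\<close>

lemma sum_fun_apply: "(\<Sum>i\<in>A. f i) x = (\<Sum>i\<in>A. f i x)"
  by (induction A rule: infinite_finite_induct) auto

lemma LB0_phi_power_in:
  "n < m \<Longrightarrow> (LB0_phi m ^^ n) (LB0_in b) i = (if i = n then b else 0)"
  by (induction n arbitrary: i) (auto simp: LB0_phi_def LB0_in_def)

section \<open>The simple Lie algebra \<open>B\<close> and the map onto \<open>LB0\<close>\<close>

context taft_simple_operators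
begin

text \<open>Only the carrier shrinks; ambient type and scalar multiplication stay, so
  \<open>span\<close> and \<open>subspace\<close> mean the same for \<open>B\<close> as for
  \<open>L\<close>.\<close>

definition B :: "('f, 'a) lie" where
  "B = \<lparr>lie_carrier = E 0, scl = scl L, brk = brk L\<rparr>"

lemma B_simps [simp]: "lie_carrier B = E 0" "scl B = scl L" "brk B = brk L"
  by (simp_all add: B_def)

lemma E_0_brk: "\<lbrakk>x \<in> E 0; y \<in> E 0\<rbrakk> \<Longrightarrow> \<langle>x, y\<rangle> \<in> E 0"
  using E_brk[of x 0 y 0] by simp

lemma B_lie_algebra: "lie_algebra B"
  unfolding lie_algebra_def lie_algebra_axioms_def
  using vector_space_axioms E_subspace E_0_brk E_carrier
  by (auto simp: brk_add_left brk_add_right brk_scl_left brk_scl_right brk_self jacobi)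

lemma B_fin_dim: assumes fin_dim shows "lie_algebra.fin_dim B"
proof -
  interpret B: lie_algebra B by (rule B_lie_algebra)
  obtain S where "finite S" "span S = E 0"
    by (rule finite_basis[OF assms E_subspace[of 0]]) (auto simp: E_carrier)
  then show ?thesis by (auto simp: B.fin_dim_def)
qed

text \<open>The preimage of an ideal of \<open>B\<close> under \<open>P 0\<close> is a
  \<open>c\<close>-invariant ideal of \<open>L\<close> containing \<open>G (N - 1)\<close>, and the
  top layer is irreducible.\<close>

lemma B_simple: "lie_algebra.simple B"
proof -
  interpret B: lie_algebra B by (rule B_lie_algebra)
  have "B.commutator (E 0) (E 0) \<noteq> {0}"
  proof -
    obtain x y where "x \<in> E 0" "y \<in> E 0" "\<langle>x, y\<rangle> \<noteq> 0" using E_0_nonabelian by blast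
    moreover have "\<langle>x, y\<rangle> \<in> B.commutator (E 0) (E 0)"
      using B.brk_in_commutator[of x "E 0" y "E 0"] calculation by simp
    ultimately show ?thesis by blast
  qed
  moreover have "J = {0} \<or> J = E 0" if J: "B.lie_ideal J" for J
  proof -
    have sJ: "subspace J" and JE: "J \<subseteq> E 0" and brJ: "\<And>x y. \<lbrakk>x \<in> E 0; y \<in> J\<rbrakk> \<Longrightarrow> \<langle>x, y\<rangle> \<in> J"
      using J unfolding B.lie_ideal_def by auto
    define H where "H = {x \<in> K. P 0 x \<in> J}"
    have "cideal H"
      by (rule cidealI)
        (auto simp: H_def subspace_0[OF sJ] subspace_add[OF sJ] subspace_scale[OF sJ] P_add P_scl P_c P_0_brk
          intro!: brJ P_E)
    moreover have "G (N - 1) \<subseteq> H"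
      using G_carrier by (auto simp: H_def P_0_radical subspace_0[OF sJ])
    moreover have "H \<subseteq> G (Suc (N - 1))" using N_ge_2 G_N by (auto simp: H_def)
    ultimately have "H = G (N - 1) \<or> H = G (Suc (N - 1))" by (rule G_irreducible)
    then show ?thesis
    proof
      assume H: "H = G (N - 1)"
      have "x = 0" if "x \<in> J" for x
      proof -
        have x: "x \<in> E 0" using that JE by blast
        then have "x \<in> G (N - 1)" using that H P_id[OF x] E_carrier by (auto simp: H_def)
        then show ?thesis using P_0_radical P_id[OF x] by simp
      qed
      then show ?thesis using subspace_0[OF sJ] by blast
    next
      assume "H = G (Suc (N - 1))"
      then have H: "H = K" using N_ge_2 G_N by simp
      have "x \<in> J" if "x \<in> E 0" for x
      proof -
        have "x \<in> H" using that H E_carrier by blast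
        then show ?thesis using P_id[OF that] by (simp add: H_def)
      qed
      then show ?thesis using JE by blast
    qed
  qed
  ultimately show ?thesis unfolding B.simple_def by simp
qed

text \<open>The eigenspace \<open>E i\<close> plays the part of the \<open>i\<close>-th copy of
  \<open>B\<close>; \<open>v ^^ i\<close>, the inverse of the \<open>i\<close>-fold shift, carries
  it to \<open>E 0\<close>.\<close>

definition theta :: "'a \<Rightarrow> nat \<Rightarrow> 'a" where
  "theta x = (\<lambda>i. if i < m then (v ^^ i) (P i x) else 0)"

lemma theta_add: "\<lbrakk>x \<in> K; y \<in> K\<rbrakk> \<Longrightarrow> theta (x + y) = theta x + theta y"
  by (auto simp: theta_def P_add v_pow_add)

lemma theta_scl: "x \<in> K \<Longrightarrow> theta (s \<cdot> x) = LB0_scl B s (theta x)"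
  by (auto simp: theta_def LB0_scl_def P_scl v_pow_scl)

lemma theta_0: "theta 0 = 0"
  by (auto simp: theta_def)

lemma theta_sum: "(\<And>i. i \<in> A \<Longrightarrow> f i \<in> K) \<Longrightarrow> theta (\<Sum>i\<in>A. f i) = (\<Sum>i\<in>A. theta (f i))"
  by (induction A rule: infinite_finite_induct) (auto simp: theta_add theta_0)

lemma theta_c: "x \<in> K \<Longrightarrow> theta (c x) = LB0_c \<zeta> B (theta x)"
  by (auto simp: theta_def LB0_c_def P_c v_pow_scl)

lemma theta_v: "x \<in> K \<Longrightarrow> theta (v x) = LB0_v (theta x)"
proof
  fix i assume x: "x \<in> K"
  \<comment> \<open>The boundary index \<open>i = m - 1\<close>: the shifted family has component 0
    there, matching \<open>v ^^ m = 0\<close>.\<close>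
  have "(v ^^ Suc i) (P (Suc i) x) = 0" if "\<not> Suc i < m" "i < m"
  proof -
    have "Suc i = m" using that by simp
    then show ?thesis using v_pow_m[of "P (Suc i) x"] x by simp
  qed
  then show "theta (v x) i = LB0_v (theta x) i"
    using x by (auto simp: theta_def LB0_v_def P_v funpow_swap1)
qed

lemma theta_E_0: "x \<in> K \<Longrightarrow> i < m \<Longrightarrow> theta x i \<in> E 0"
  using v_pow_E[of "P i x" i 0] P_E by (simp add: theta_def)

lemma theta_bij: "bij_betw theta K (lie_carrier (LB0 m \<zeta> B))"
proof (rule bij_betw_imageI)
  show "inj_on theta K"
  proof (rule inj_onI)
    fix x y assume xy: "x \<in> K" "y \<in> K" "theta x = theta y"
    have "P i (x - y) = 0" if "i < m" for i
    proof -
      have "theta x i = theta y i" using xy by simp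
      then have "(v ^^ i) (P i (x - y)) = 0"
        using xy that by (simp add: theta_def P_diff v_pow_diff)
      then show ?thesis using v_pow_inj_E[OF P_E] xy that by simp
    qed
    then have "(\<Sum>i<m. P i (x - y)) = 0" by simp
    then show "x = y" using sum_P[of "x - y"] xy by simp
  qed
  show "theta ` K = lie_carrier (LB0 m \<zeta> B)"
  proof
    show "theta ` K \<subseteq> lie_carrier (LB0 m \<zeta> B)"
      using theta_E_0 by (auto simp: LB0_def) (auto simp: theta_def)
    show "lie_carrier (LB0 m \<zeta> B) \<subseteq> theta ` K"
    proof
      fix y assume "y \<in> lie_carrier (LB0 m \<zeta> B)"
      then have y: "\<And>i. i < m \<Longrightarrow> y i \<in> E 0" "\<And>i. i \<ge> m \<Longrightarrow> y i = 0" by (auto simp: LB0_def)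
      \<comment> \<open>Preimages under \<open>v ^^ i\<close> exist for indices below
        \<open>N\<close>; since \<open>N = m\<close>, every component of \<open>y\<close> is
        covered.\<close>
      have "\<forall>i. \<exists>x. i < m \<longrightarrow> x \<in> E i \<and> (v ^^ i) x = y i"
        using v_pow_surj_E y(1) unfolding N_eq_m by blast
      then obtain f where f: "\<And>i. i < m \<Longrightarrow> f i \<in> E i \<and> (v ^^ i) (f i) = y i" by metis
      have fK: "f i \<in> K" if "i < m" for i using f[OF that] E_carrier by blast
      have Pf: "P i (\<Sum>j<m. f j) = f i" if i: "i < m" for i
      proof -
        have "P i (\<Sum>j<m. f j) = (\<Sum>j<m. P i (f j))" using fK by (intro P_sum) simp
        also have "\<dots> = (\<Sum>j<m. if j = i then f i else 0)"
        proof (rule sum.cong)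
          fix j assume "j \<in> {..<m}"
          then show "P i (f j) = (if j = i then f i else 0)"
            using f[of j] i P_id P_other[of "f j" j i] by auto
        qed rule
        finally show ?thesis using i by simp
      qed
      have "theta (\<Sum>j<m. f j) i = y i" for i
        using Pf f y(2) by (simp add: theta_def)
      then have "y = theta (\<Sum>j<m. f j)" by auto
      moreover have "(\<Sum>j<m. f j) \<in> K" using fK by (intro carrier_sum) simp
      ultimately show "y \<in> theta ` K" by blast
    qed
  qed
qed

text \<open>Both sides are compared on pairs of eigencomponents: \<open>v_pow_brk\<close> gives the
  quantum binomial coefficient for \<open>k + l < m\<close>, and the filtration with
  \<open>N = m\<close> gives zero otherwise.\<close>

lemma theta_brk:
  assumes x: "x \<in> K" and y: "y \<in> K"
  shows "theta \<langle>x, y\<rangle> = LB0_brk m \<zeta> B (theta x) (theta y)"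
proof
  fix i
  have term_eq: "theta \<langle>P k x, P l y\<rangle> i
      = (if k + l < m then LB0_scl B (q_binom \<zeta> (k + l) k)
          ((LB0_phi m ^^ (k + l)) (LB0_in (brk B (theta x k) (theta y l)))) else 0) i"
    if kl: "k < m" "l < m" for k l
  proof (cases "k + l < m")
    case False
    have "\<langle>P k x, P l y\<rangle> = 0"
      using brk_E_eq_0[OF P_E[OF x] P_E[OF y] kl] False by (simp add: N_eq_m)
    then show ?thesis using False by (simp add: theta_0)
  next
    case True
    have "\<langle>P k x, P l y\<rangle> \<in> E (k + l)" by (intro E_brk P_E x y)
    then have "theta \<langle>P k x, P l y\<rangle> i = (if i = k + l then (v ^^ (k + l)) \<langle>P k x, P l y\<rangle> else 0)"
      using P_id P_other[of _ "k + l" i] True by (auto simp: theta_def)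
    also have "\<dots> = (if i = k + l then q_binom \<zeta> (k + l) k \<cdot> \<langle>theta x k, theta y l\<rangle> else 0)"
      using v_pow_brk[OF P_E[OF x] P_E[OF y] True] kl by (simp add: theta_def)
    finally show ?thesis using True by (simp add: LB0_scl_def LB0_phi_power_in)
  qed
  have "\<langle>x, y\<rangle> = \<langle>\<Sum>k<m. P k x, \<Sum>l<m. P l y\<rangle>" using x y by (simp add: sum_P)
  also have "\<dots> = (\<Sum>k<m. \<Sum>l<m. \<langle>P k x, P l y\<rangle>)"
    using x y by (simp add: brk_sum_left brk_sum_right) (rule sum.swap)
  finally have "theta \<langle>x, y\<rangle> i = (\<Sum>k<m. \<Sum>l<m. theta \<langle>P k x, P l y\<rangle> i)"
    using x y by (simp add: theta_sum sum_fun_apply)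
  then show "theta \<langle>x, y\<rangle> i = LB0_brk m \<zeta> B (theta x) (theta y) i"
    unfolding LB0_brk_def sum_fun_apply by (simp add: term_eq)
qed

lemma theta_free_op:
  assumes x: "x \<in> K"
  shows "theta (free_op (scl L) c v p x) = free_op (LB0_scl B) (LB0_c \<zeta> B) LB0_v p (theta x)"
proof -
  have *: "foldr (gen_op c v) gs x \<in> K \<and>
      theta (foldr (gen_op c v) gs x) = foldr (gen_op (LB0_c \<zeta> B) LB0_v) gs (theta x)" for gs
  proof (induction gs)
    case (Cons g gs)
    then show ?case by (cases g) (auto simp: theta_c theta_v)
  qed (simp add: x)
  then show ?thesis by (simp add: free_op_def theta_sum theta_scl)
qed

end

section \<open>Return from the operators to modules over the Taft algebra\<close>

theorem theorem5p1:
  fixes m :: nat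
    and \<zeta> :: "'f::{alg_closed_field, field_char_0}"
    and L :: "('f, 'a::ab_group_add) taft_lie"
  assumes "m \<ge> 2"
    and "primitive_root m \<zeta>"
    and "taft_module_lie_algebra m \<zeta> L"
    and "lie_algebra.fin_dim L"
    and "taft_module_lie_algebra.taft_simple m \<zeta> L"
    and "lie_algebra.solvable_radical L \<noteq> {0}"
  shows "\<exists>B :: ('f, 'a) lie.
           lie_algebra B \<and> lie_algebra.fin_dim B \<and> lie_algebra.simple B \<and>
           taft_lie_isomorphic m \<zeta> L (LB0 m \<zeta> B)"
proof -
  interpret taft_module_lie_algebra m \<zeta> L by fact
  interpret ops: taft_operators L m \<zeta> c_op v_op
    using taft_operators_act[OF assms(3,1,2)] .
  obtain I where I: "ops.cideal I" "I \<noteq> {0}" "\<And>x y. \<lbrakk>x \<in> I; y \<in> I\<rbrakk> \<Longrightarrow> brk L x y = 0"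
    "\<And>J. \<lbrakk>ops.cideal J; J \<subseteq> I\<rbrakk> \<Longrightarrow> J = {0} \<or> J = I"
    using ops.minimal_abelian_cideal[OF assms(4,6)] by blast
  interpret ops: taft_simple_operators L m \<zeta> c_op v_op I
  proof
    show "commutator K K \<noteq> {0}" using assms(5) by (simp add: taft_simple_def)
    show "J = {0} \<or> J = K" if J: "ops.cideal J" "v_op ` J \<subseteq> J" for J
    proof -
      have "lie_ideal J" "c_op ` J \<subseteq> J" using J by (auto simp: ops.cideal_def)
      \<comment> \<open>Stability under the two generators gives stability under the whole Taft
        algebra, so module simplicity becomes simplicity for the operators.\<close>
      moreover have "invariant J"
        using J calculation by (intro invariantI) (auto simp: lie_ideal_def)
      ultimately show ?thesis using assms(5) by (simp add: taft_simple_def)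
    qed
  qed (use I in auto)
  have act: "ops.theta (act L h x) = act (LB0 m \<zeta> ops.B) h (ops.theta x)"
    if h: "h \<in> carrier (taft_algebra m \<zeta>)" and x: "x \<in> K" for h x
  proof -
    obtain p where p: "h = cls p" using taft_class_cases[OF h] .
    \<comment> \<open>The action on \<open>LB0\<close> picks the unique value over all
      representatives of \<open>h\<close>. Any representative \<open>q\<close> yields the
      transported action of \<open>h\<close>, so the set of values is a singleton.\<close>
    have "free_op (LB0_scl ops.B) (LB0_c \<zeta> ops.B) LB0_v q (ops.theta x) = ops.theta (act L h x)"
      if "q \<in> h" for q
    proof -
      have "h = cls q" using that p taft_class_eq[of q m \<zeta> p] by simp
      then show ?thesis using x by (simp add: act_free_op ops.theta_free_op)
    qed
    moreover have "p \<in> h" unfolding p by (rule taft_class_self)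
    ultimately have "(\<lambda>q. free_op (LB0_scl ops.B) (LB0_c \<zeta> ops.B) LB0_v q (ops.theta x)) ` h
        = {ops.theta (act L h x)}" by force
    then show ?thesis by (simp add: LB0_def taft_op_def)
  qed
  have "taft_lie_isomorphic m \<zeta> L (LB0 m \<zeta> ops.B)"
    unfolding taft_lie_isomorphic_def
    by (intro exI[of _ ops.theta] conjI ballI allI ops.theta_bij)
      (auto simp: act ops.theta_add, auto simp: LB0_def ops.theta_scl ops.theta_brk)
  then show ?thesis using ops.B_lie_algebra ops.B_fin_dim[OF assms(4)] ops.B_simple by blast
qed

end
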